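(* Let $G$ be a topological group and let $V$ be a continuous weakly almost periodic (wap) Banach $G$-module. Let $N$ and $C$ be subgroups of $G$ such that $C$ is contained in the centralizer of $N$ in $G$. If $V^C=\{0\}$, then for every $n\geq 0$ the restriction map $$\bar H_c^n(G,V)\to \bar H_c^n(N,V)$$ in reduced continuous cohomology is zero. In particular, if $\alpha$ is a continuous affine isometric action of $G$ on a Banach space $V$ whose linear part $\rho$ is weakly almost periodic and such that $\rho(C)$ has no non-zero fixed vector in $V$, then the restriction of $\alpha$ to $N$ almost fixes a point on $V$.
   Context: Banach spaces are over the real or complex numbers. A Banach $G$-module is a Banach space $V$ with a linear representation $\rho\colon G\to GL(V)$ by invertible bounded operators. It is continuous if for every $v\in V$ the map $g\mapsto\rho(g)v$ is continuous from $G$ to $V$ with the norm topology. It (or $\rho$) is weakly almost periodic (wap) if for every $v\in V$ the orbit $\rho(G)v$ is relatively weakly compact in $V$. For a subgroup $H\leq G$, $V^H$ is the subspace of vectors fixed by all $\rho(h)$, $h\in H$. Subgroups carry the subspace topology, and $V$ is viewed as an $N$-module by restricting $\rho$. Reduced continuous cohomology: for a topological group $G$ and a continuous Banach $G$-module $V$, let $C(G^{n+1},V)$ be the space of continuous maps $G^{n+1}\to V$ (norm topology on $V$), with the compact-open topology, and let $C(G^{n+1},V)^G$ be the subspace of $G$-equivariant maps, i.e. $c(gg_0,\dots,gg_n)=\rho(g)c(g_0,\dots,g_n)$. The differential $\partial\colon C(G^{n},V)^G\to C(G^{n+1},V)^G$ is $(\partial c)(g_0,\dots,g_n)=\sum_{k=0}^n(-1)^k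 c(g_0,\dots,\widehat{g_k},\dots,g_n)$; the complex $C(G^{*+1},V)^G$ starts in degree $0$ with $C(G,V)^G$. Let $Z^n(G,V)\subset C(G^{n+1},V)^G$ be the kernel of $\partial$ and $B^n(G,V)\subset C(G^{n+1},V)^G$ the image of $\partial$ (with $B^0=0$). Then $\bar H_c^n(G,V)=Z^n(G,V)/\overline{B^n(G,V)}$, the closure being in the compact-open topology. The restriction map is induced by restricting cochains from $G^{n+1}$ to $N^{n+1}$. An affine isometric action $\alpha$ of $G$ on $V$ with linear part $\rho$ is an action of the form $\alpha(g)v=\rho(g)v+b(g)$ with $\rho\colon G\to GL(V)$ an isometric linear representation and $b\colon G\to V$; it is continuous if $g\mapsto\alpha(g)v$ is norm continuous for every $v\in V$. An affine isometric action $\alpha$ of a topological group $H$ on $V$ almost fixes a point on $V$ if for every compact $K\subseteq H$ and every $\epsilon>0$ there is $v\in V$ with $\|\alpha(h)v-v\|<\epsilon$ for all $h\in K$. *)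

theory Defs
  imports "HOL-Analysis.Analysis" "HOL-Algebra.Group_Action"
begin

section \<open>Banach spaces over the real or complex numbers\<close>

text \<open>
  The scalar field is a type of the following class, whose instances are, up to isomorphism,
  exactly the real and the complex numbers.
\<close>

class real_or_complex = real_normed_field +
  assumes real_or_complex:
    "(\<forall>x. \<exists>a. x = a *\<^sub>R 1) \<or>
     (\<exists>i. i * i = - 1 \<and> (\<forall>x. \<exists>a b. x = a *\<^sub>R 1 + b *\<^sub>R i))"

instance real :: real_or_complex
  by standard simp

instance complex :: real_or_complex
proof
  have "\<exists>a b. x = a *\<^sub>R 1 + b *\<^sub>R \<i>" for x :: complex
    by (rule exI[of _ "Re x"], rule exI[of _ "Im x"]) (simp add: complex_eq_iff)
  then show "(\<forall>x::complex. \<exists>a. x = a *\<^sub>R 1) \<or>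
     (\<exists>i::complex. i * i = - 1 \<and> (\<forall>x. \<exists>a b. x = a *\<^sub>R 1 + b *\<^sub>R i))"
    using i_squared by blast
qed

text \<open>
  The class \<^class>\<open>banach\<close> provides only real Banach spaces; a Banach space over the field
  \<open>'k\<close> is such a space with a compatible scalar multiplication \<open>scl\<close> by \<open>'k\<close>.
  For \<open>'k = real\<close> the compatibility forces \<open>scl = scaleR\<close>.
\<close>

locale banach_space = vector_space scl
  for scl :: "'k::real_or_complex \<Rightarrow> 'v::banach \<Rightarrow> 'v" +
  assumes scale_of_real: "scl (of_real r) v = r *\<^sub>R v"
    and norm_scale: "norm (scl a v) = norm a * norm v"

definition bounded_operator ::
    "('k::real_or_complex \<Rightarrow> 'v::banach \<Rightarrow> 'v) \<Rightarrow> ('v \<Rightarrow> 'v) \<Rightarrow> bool"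
  where "bounded_operator scl A \<longleftrightarrow> Vector_Spaces.linear scl scl A \<and> bounded_linear A"

definition bounded_functional ::
    "('k::real_or_complex \<Rightarrow> 'v::banach \<Rightarrow> 'v) \<Rightarrow> ('v \<Rightarrow> 'k) \<Rightarrow> bool"
  where "bounded_functional scl \<phi> \<longleftrightarrow> Vector_Spaces.linear scl (*) \<phi> \<and> bounded_linear \<phi>"

definition weak_topology ::
    "('k::real_or_complex \<Rightarrow> 'v::banach \<Rightarrow> 'v) \<Rightarrow> 'v topology"
  where "weak_topology scl =
    topology_generated_by {\<phi> -` U | \<phi> U. bounded_functional scl \<phi> \<and> open U}"

definition GL :: "('k::real_or_complex \<Rightarrow> 'v::banach \<Rightarrow> 'v) \<Rightarrow> ('v \<Rightarrow> 'v) monoid"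
  where "GL scl =
    \<lparr>carrier = {A. bounded_operator scl A \<and>
        (\<exists>B. bounded_operator scl B \<and> A \<circ> B = id \<and> B \<circ> A = id)},
     mult = (\<circ>), one = id\<rparr>"


section \<open>Topological groups and Banach modules\<close>

text \<open>No separation axiom is assumed.\<close>

locale topological_group = group G for G (structure) +
  fixes T
  assumes topspace_eq: "topspace T = carrier G"
    and continuous_mult: "continuous_map (prod_topology T T) T (\<lambda>(x, y). x \<otimes> y)"
    and continuous_inv: "continuous_map T T (\<lambda>x. inv x)"

definition centralizer :: "('g, 's) monoid_scheme \<Rightarrow> 'g set \<Rightarrow> 'g set"
  where "centralizer G N = {g \<in> carrier G. \<forall>x\<in>N. g \<otimes>\<^bsub>G\<^esub> x = x \<otimes>\<^bsub>G\<^esub> g}"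

definition banach_module ::
    "('k::real_or_complex \<Rightarrow> 'v::banach \<Rightarrow> 'v) \<Rightarrow> ('g, 's) monoid_scheme
      \<Rightarrow> ('g \<Rightarrow> 'v \<Rightarrow> 'v) \<Rightarrow> bool"
  where "banach_module scl G \<rho> \<longleftrightarrow> banach_space scl \<and> \<rho> \<in> hom G (GL scl)"

definition pointwise_continuous :: "'g topology \<Rightarrow> ('g \<Rightarrow> 'v \<Rightarrow> 'v::banach) \<Rightarrow> bool"
  where "pointwise_continuous T \<alpha> \<longleftrightarrow> (\<forall>v. continuous_map T euclidean (\<lambda>g. \<alpha> g v))"

definition weakly_almost_periodic ::
    "('k::real_or_complex \<Rightarrow> 'v::banach \<Rightarrow> 'v) \<Rightarrow> ('g, 's) monoid_scheme
      \<Rightarrow> ('g \<Rightarrow> 'v \<Rightarrow> 'v) \<Rightarrow> bool"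
  where "weakly_almost_periodic scl G \<rho> \<longleftrightarrow>
    (\<forall>v. compactin (weak_topology scl) (weak_topology scl closure_of Group_Action.orbit G \<rho> v))"

definition fixed_vectors :: "('g \<Rightarrow> 'v \<Rightarrow> 'v) \<Rightarrow> 'g set \<Rightarrow> 'v set"
  where "fixed_vectors \<rho> H = {v. \<forall>h\<in>H. \<rho> h v = v}"


section \<open>Reduced continuous cohomology\<close>

text \<open>
  Continuous maps on \<open>X\<close> are represented by functions on the underlying type that vanish
  outside \<open>topspace X\<close>, so that they form a vector space under pointwise operations.
\<close>

definition continuous_maps :: "'x topology \<Rightarrow> ('x \<Rightarrow> 'v::banach) set"
  where "continuous_maps X =
    {f. continuous_map X euclidean f \<and> (\<forall>x. x \<notin> topspace X \<longrightarrow> f x = 0)}"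

definition compact_open_topology :: "'x topology \<Rightarrow> ('x \<Rightarrow> 'v::banach) topology"
  where "compact_open_topology X =
    topology_generated_by
      {{f \<in> continuous_maps X. f ` K \<subseteq> U} | K U. compactin X K \<and> open U}"

text \<open>
  The topological space \<open>G\<^sup>m\<close>: its points are the maps \<open>x\<close> from \<open>{..<m}\<close> to the group, extended
  by \<^const>\<open>undefined\<close>, where \<open>x i\<close> is the entry of the tuple at position \<open>i\<close>.
\<close>

abbreviation power_topology :: "'g topology \<Rightarrow> nat \<Rightarrow> (nat \<Rightarrow> 'g) topology"
  where "power_topology T m \<equiv> product_topology (\<lambda>_. T) {..<m}"

definition translate :: "('g, 's) monoid_scheme \<Rightarrow> nat \<Rightarrow> 'g \<Rightarrow> (nat \<Rightarrow> 'g) \<Rightarrow> (nat \<Rightarrow> 'g)"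
  where "translate G m g x = (\<lambda>i\<in>{..<m}. g \<otimes>\<^bsub>G\<^esub> x i)"

definition omit :: "nat \<Rightarrow> nat \<Rightarrow> (nat \<Rightarrow> 'g) \<Rightarrow> (nat \<Rightarrow> 'g)"
  where "omit m k x = (\<lambda>i\<in>{..<m}. if i < k then x i else x (Suc i))"

text \<open>The space \<open>C(G\<^sup>m, V)\<^sup>G\<close>; note that degree \<open>n\<close> cochains correspond to \<open>m = n + 1\<close>.\<close>

definition equivariant_maps ::
    "('g, 's) monoid_scheme \<Rightarrow> 'g topology \<Rightarrow> ('g \<Rightarrow> 'v \<Rightarrow> 'v::banach) \<Rightarrow> nat
      \<Rightarrow> ((nat \<Rightarrow> 'g) \<Rightarrow> 'v) set"
  where "equivariant_maps G T \<rho> m =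
    {c \<in> continuous_maps (power_topology T m).
      \<forall>g\<in>carrier G. \<forall>x\<in>topspace (power_topology T m). c (translate G m g x) = \<rho> g (c x)}"

text \<open>\<open>differential T n\<close> maps \<open>C(G\<^sup>n, V)\<^sup>G\<close> to \<open>C(G\<^sup>n\<^sup>+\<^sup>1, V)\<^sup>G\<close>.\<close>

definition differential ::
    "'g topology \<Rightarrow> nat \<Rightarrow> ((nat \<Rightarrow> 'g) \<Rightarrow> 'v::banach) \<Rightarrow> ((nat \<Rightarrow> 'g) \<Rightarrow> 'v)"
  where "differential T n c = (\<lambda>x.
    if x \<in> topspace (power_topology T (Suc n))
    then \<Sum>k\<le>n. (- 1) ^ k *\<^sub>R c (omit n k x) else 0)"

definition cocycles ::
    "('g, 's) monoid_scheme \<Rightarrow> 'g topology \<Rightarrow> ('g \<Rightarrow> 'v \<Rightarrow> 'v::banach) \<Rightarrow> nat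
      \<Rightarrow> ((nat \<Rightarrow> 'g) \<Rightarrow> 'v) set"
  where "cocycles G T \<rho> n =
    {c \<in> equivariant_maps G T \<rho> (Suc n). differential T (Suc n) c = (\<lambda>_. 0)}"

text \<open>
  The complex starts with \<open>C(G, V)\<^sup>G\<close>, so \<open>C(G\<^sup>0, V)\<^sup>G\<close> does not contribute coboundaries.
\<close>

definition coboundaries ::
    "('g, 's) monoid_scheme \<Rightarrow> 'g topology \<Rightarrow> ('g \<Rightarrow> 'v \<Rightarrow> 'v::banach) \<Rightarrow> nat
      \<Rightarrow> ((nat \<Rightarrow> 'g) \<Rightarrow> 'v) set"
  where "coboundaries G T \<rho> n =
    (if n = 0 then {\<lambda>_. 0} else differential T n ` equivariant_maps G T \<rho> n)"

definition closed_coboundaries ::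
    "('g, 's) monoid_scheme \<Rightarrow> 'g topology \<Rightarrow> ('g \<Rightarrow> 'v \<Rightarrow> 'v::banach) \<Rightarrow> nat
      \<Rightarrow> ((nat \<Rightarrow> 'g) \<Rightarrow> 'v) set"
  where "closed_coboundaries G T \<rho> n =
    subtopology (compact_open_topology (power_topology T (Suc n))) (equivariant_maps G T \<rho> (Suc n))
      closure_of coboundaries G T \<rho> n"

definition cohomologous ::
    "('g, 's) monoid_scheme \<Rightarrow> 'g topology \<Rightarrow> ('g \<Rightarrow> 'v \<Rightarrow> 'v::banach) \<Rightarrow> nat
      \<Rightarrow> ((nat \<Rightarrow> 'g) \<Rightarrow> 'v) rel"
  where "cohomologous G T \<rho> n =
    {(c, c'). c \<in> cocycles G T \<rho> n \<and> c' \<in> cocycles G T \<rho> n \<and>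
      (\<lambda>x. c x - c' x) \<in> closed_coboundaries G T \<rho> n}"

definition reduced_cohomology ::
    "('g, 's) monoid_scheme \<Rightarrow> 'g topology \<Rightarrow> ('g \<Rightarrow> 'v \<Rightarrow> 'v::banach) \<Rightarrow> nat
      \<Rightarrow> ((nat \<Rightarrow> 'g) \<Rightarrow> 'v) set set"
  where "reduced_cohomology G T \<rho> n = cocycles G T \<rho> n // cohomologous G T \<rho> n"

definition cohomology_class ::
    "('g, 's) monoid_scheme \<Rightarrow> 'g topology \<Rightarrow> ('g \<Rightarrow> 'v \<Rightarrow> 'v::banach) \<Rightarrow> nat
      \<Rightarrow> ((nat \<Rightarrow> 'g) \<Rightarrow> 'v) \<Rightarrow> ((nat \<Rightarrow> 'g) \<Rightarrow> 'v) set"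
  where "cohomology_class G T \<rho> n c = cohomologous G T \<rho> n `` {c}"

definition restrict_cochain ::
    "'g topology \<Rightarrow> 'g set \<Rightarrow> nat \<Rightarrow> ((nat \<Rightarrow> 'g) \<Rightarrow> 'v::banach) \<Rightarrow> ((nat \<Rightarrow> 'g) \<Rightarrow> 'v)"
  where "restrict_cochain T N n c = (\<lambda>x.
    if x \<in> topspace (power_topology (subtopology T N) (Suc n)) then c x else 0)"

text \<open>
  The induced map on classes: the union over all representatives is the usual way to lift a
  function that respects an equivalence relation to the quotient.
\<close>

definition restriction_map ::
    "('g, 's) monoid_scheme \<Rightarrow> 'g topology \<Rightarrow> ('g \<Rightarrow> 'v \<Rightarrow> 'v::banach) \<Rightarrow> 'g set \<Rightarrow> nat
      \<Rightarrow> ((nat \<Rightarrow> 'g) \<Rightarrow> 'v) set \<Rightarrow> ((nat \<Rightarrow> 'g) \<Rightarrow> 'v) set"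
  where "restriction_map G T \<rho> N n \<xi> =
    (\<Union>c\<in>\<xi>. cohomology_class (G\<lparr>carrier := N\<rparr>) (subtopology T N) \<rho> n (restrict_cochain T N n c))"


section \<open>Affine isometric actions\<close>

definition affine_isometric_action ::
    "('k::real_or_complex \<Rightarrow> 'v::banach \<Rightarrow> 'v) \<Rightarrow> ('g, 's) monoid_scheme
      \<Rightarrow> ('g \<Rightarrow> 'v \<Rightarrow> 'v) \<Rightarrow> ('g \<Rightarrow> 'v \<Rightarrow> 'v) \<Rightarrow> ('g \<Rightarrow> 'v) \<Rightarrow> bool"
  where "affine_isometric_action scl G \<alpha> \<rho> b \<longleftrightarrow>
    group_action G UNIV \<alpha> \<and> banach_module scl G \<rho> \<and>
    (\<forall>g\<in>carrier G. \<forall>v. norm (\<rho> g v) = norm v) \<and>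
    (\<forall>g\<in>carrier G. \<forall>v. \<alpha> g v = \<rho> g v + b g)"

definition almost_fixes_point :: "'g topology \<Rightarrow> ('g \<Rightarrow> 'v \<Rightarrow> 'v::banach) \<Rightarrow> bool"
  where "almost_fixes_point T \<alpha> \<longleftrightarrow>
    (\<forall>K \<epsilon>. compactin T K \<and> \<epsilon> > 0 \<longrightarrow> (\<exists>v. \<forall>h\<in>K. norm (\<alpha> h v - v) < \<epsilon>))"

end

theory Submission
  imports Defs
begin

text \<open>
  For \<open>z\<close> in \<open>C\<close> and a cocycle \<open>c\<close> on \<open>G\<close>, the restrictions of \<open>c\<close> and \<open>\<rho>(z) c\<close> to \<open>N\<close> differ by a
  coboundary: since \<open>z\<close> commutes with \<open>N\<close>, \<open>\<rho>(z) c\<close> is the translate of \<open>c\<close> by \<open>z\<close> from the right, which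
  is homotopic to \<open>c\<close>. The same holds for \<open>m c\<close>, where \<open>m\<close> is any convex combination of operators in
  \<open>\<rho>(C)\<close>, so it suffices to find such an \<open>m\<close> that is small on a given norm compact set.

  Such averages exist by a mean ergodic theorem. In the weak closure of an orbit of \<open>\<rho>(C)\<close>, a minimal
  invariant weakly closed set \<open>K\<close> is norm compact: weakly compact sets have relatively weakly open
  pieces of small norm diameter, and finitely many translates of such a piece cover \<open>K\<close>. Kakutani's
  argument gives a fixed point in the closed convex hull of \<open>K\<close>, which must be \<open>0\<close>. Hence every vector
  can be averaged to nearly \<open>0\<close>, and then so can finitely many, one after the other.
\<close>

section \<open>The Hahn--Banach theorem\<close>

text \<open>\<open>C\<close> is an arbitrary group, so no invariant mean is at hand; a fixed point
  in the closed convex hull of each orbit takes its place. Kakutani's argument needs finite covers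
  by norm balls, which a weakly compact orbit closure does not offer in general; this is why a
  minimal set is chosen first. Invertibility matters there: a piece of small diameter stays small
  when pulled back through an operator because the inverse obeys the same uniform bound. The
  argument also needs isometries, and the supremum of the norm over an orbit supplies a norm for
  which the operators are isometries.

  No limit of averages is ever taken. The closure of the coboundaries asks for approximation on one
  compact set at a time, so \<open>m\<close> may depend on that set and on \<epsilon>, and the
  property that \<open>c - m c\<close> is a coboundary only has to survive finite convex
  combinations. The affine statement is proved from the cocycle identity for \<open>b\<close>
  directly, as the degree one shadow of the same homotopy.\<close>

definition sublinear :: "('v::real_vector \<Rightarrow> real) \<Rightarrow> bool"
  where "sublinear p \<longleftrightarrow> (\<forall>x y. p (x + y) \<le> p x + p y) \<and> (\<forall>t x. 0 \<le> t \<longrightarrow> p (t *\<^sub>R x) = t * p x)"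

lemma sublinear_add: "sublinear p \<Longrightarrow> p (x + y) \<le> p x + p y"
  by (simp add: sublinear_def)

lemma sublinear_scale: "sublinear p \<Longrightarrow> 0 \<le> t \<Longrightarrow> p (t *\<^sub>R x) = t * p x"
  by (simp add: sublinear_def)

lemma sublinear_zero: "sublinear p \<Longrightarrow> p 0 = 0"
  using sublinear_scale[of p 0 0] by simp

lemma sublinear_minus_le: "sublinear p \<Longrightarrow> - p (- x) \<le> p x"
  using sublinear_add[of p x "- x"] by (simp add: sublinear_zero)

text \<open>One inequality for scaling is enough: applied to the inverse factor, it gives the
  reverse one.\<close>

lemma sublinearI:
  assumes add: "\<And>x y. p (x + y) \<le> p x + p y"
    and zero: "p 0 = 0"
    and scale: "\<And>t x. 0 < t \<Longrightarrow> p (t *\<^sub>R x) \<le> t * p x"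
  shows "sublinear p"
  unfolding sublinear_def
proof (intro conjI allI impI add)
  fix t :: real and x assume "0 \<le> t"
  show "p (t *\<^sub>R x) = t * p x"
  proof (cases "t = 0")
    case False
    with \<open>0 \<le> t\<close> have t: "0 < t" by simp
    have "p x \<le> inverse t * p (t *\<^sub>R x)"
      using scale[of "inverse t" "t *\<^sub>R x"] t by simp
    then have "t * p x \<le> p (t *\<^sub>R x)"
      using t by (simp add: field_simps)
    with scale[OF t, of x] show ?thesis by simp
  qed (simp add: zero)
qed

text \<open>The infimum at \<open>x\<close> and the one at \<open>y\<close> may be approached along
  different members \<open>q\<close> and \<open>q'\<close>. In a chain some member lies below both,
  and its own subadditivity bounds the infimum at \<open>x + y\<close>.\<close>

lemma sublinear_INF:
  fixes Q :: "('v::real_vector \<Rightarrow> real) set"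
  assumes "Q \<noteq> {}" and sub: "\<And>q. q \<in> Q \<Longrightarrow> sublinear q"
    and chain: "\<And>q q'. q \<in> Q \<Longrightarrow> q' \<in> Q \<Longrightarrow> q \<le> q' \<or> q' \<le> q"
    and bdd: "\<And>x. bdd_below ((\<lambda>q. q x) ` Q)"
  shows "sublinear (\<lambda>x. INF q\<in>Q. q x)"
proof (rule sublinearI)
  have low: "(INF q\<in>Q. q x) \<le> q x" if "q \<in> Q" for q x
    using cINF_lower[OF bdd that] .
  fix x y
  have *: "(INF q\<in>Q. q (x + y)) \<le> q x + q' y" if qq: "q \<in> Q" "q' \<in> Q" for q q'
  proof -
    obtain r where r: "r \<in> Q" "r \<le> q" "r \<le> q'"
      using chain[OF qq] qq order_refl by metis
    have "(INF q\<in>Q. q (x + y)) \<le> r (x + y)" using low r by blast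
    also have "\<dots> \<le> r x + r y" using sub r sublinear_add by blast
    also have "\<dots> \<le> q x + q' y" using r by (simp add: le_fun_def add_mono)
    finally show ?thesis .
  qed
  have "(INF q\<in>Q. q (x + y)) - q' y \<le> (INF q\<in>Q. q x)" if "q' \<in> Q" for q'
    by (rule cINF_greatest[OF \<open>Q \<noteq> {}\<close>]) (use *[OF _ that] in \<open>simp add: algebra_simps\<close>)
  then have "(INF q\<in>Q. q (x + y)) - (INF q\<in>Q. q x) \<le> (INF q\<in>Q. q y)"
    by (intro cINF_greatest[OF \<open>Q \<noteq> {}\<close>]) (simp add: algebra_simps)
  then show "(INF q\<in>Q. q (x + y)) \<le> (INF q\<in>Q. q x) + (INF q\<in>Q. q y)"
    by simp
next
  have "(INF q\<in>Q. q 0) = (INF q\<in>Q. 0)"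
    by (rule INF_cong) (auto simp: sublinear_zero sub)
  then show "(INF q\<in>Q. q 0) = 0" using \<open>Q \<noteq> {}\<close> by simp
next
  fix t :: real and x :: 'v assume t: "0 < t"
  have "inverse t * (INF q\<in>Q. q (t *\<^sub>R x)) \<le> (INF q\<in>Q. q x)"
  proof (rule cINF_greatest[OF \<open>Q \<noteq> {}\<close>])
    fix q assume q: "q \<in> Q"
    have "(INF q\<in>Q. q (t *\<^sub>R x)) \<le> q (t *\<^sub>R x)" by (rule cINF_lower[OF bdd q])
    also have "\<dots> = t * q x" using sub[OF q] t by (simp add: sublinear_scale)
    finally show "inverse t * (INF q\<in>Q. q (t *\<^sub>R x)) \<le> q x"
      using t by (simp add: field_simps)
  qed
  then show "(INF q\<in>Q. q (t *\<^sub>R x)) \<le> t * (INF q\<in>Q. q x)"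
    using t by (simp add: field_simps)
qed

text \<open>A minimal sublinear functional is linear: otherwise the infimal functional \<open>r\<close> below, which
  makes \<open>q\<close> linear along the line through \<open>y\<close>, would be smaller.\<close>

theorem linear_below_sublinear:
  fixes p :: "'v::real_vector \<Rightarrow> real"
  assumes p: "sublinear p"
  obtains f where "linear f" "\<And>x. f x \<le> p x"
proof -
  define A where "A = {q. sublinear q \<and> q \<le> p}"
  have "\<exists>m\<in>A. \<forall>a\<in>A. a \<le> m \<longrightarrow> a = m"
  proof (rule predicate_Zorn[of A "\<lambda>x y. y \<le> x"])
    show "partial_order_on A (relation_of (\<lambda>x y. y \<le> x) A)"
      by (rule partial_order_on_relation_ofI) auto
    fix Q assume "Q \<in> Chains (relation_of (\<lambda>x y. y \<le> x) A)"
    then have QA: "\<And>q. q \<in> Q \<Longrightarrow> q \<in> A"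
      and chain: "\<And>q q'. q \<in> Q \<Longrightarrow> q' \<in> Q \<Longrightarrow> q \<le> q' \<or> q' \<le> q"
      by (auto simp: Chains_def relation_of_def)
    show "\<exists>u\<in>A. \<forall>a\<in>Q. u \<le> a"
    proof (cases "Q = {}")
      case True
      then show ?thesis using p by (auto simp: A_def)
    next
      case False
      \<comment> \<open>The infimum along the chain is finite: \<open>q \<le> p\<close> at
        \<open>- x\<close> gives \<open>- p (- x) \<le> - q (- x)\<close>, and the latter is at most
        \<open>q x\<close>.\<close>
      have bdd: "bdd_below ((\<lambda>q. q x) ` Q)" for x
      proof (rule bdd_belowI2)
        fix q assume "q \<in> Q"
        then have "sublinear q" "q \<le> p" using QA by (auto simp: A_def)
        then show "- p (- x) \<le> q x"
          using sublinear_minus_le[of q x] by (auto simp: le_fun_def intro: order_trans[rotated])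
      qed
      let ?u = "\<lambda>x. INF q\<in>Q. q x"
      have low: "?u \<le> q" if "q \<in> Q" for q
        using cINF_lower[OF bdd that] by (simp add: le_fun_def)
      have "sublinear ?u"
        by (rule sublinear_INF[OF False _ chain bdd]) (use QA in \<open>auto simp: A_def\<close>)
      moreover have "?u \<le> p"
        using False low QA by (metis (mono_tags, lifting) A_def ex_in_conv mem_Collect_eq order_trans)
      ultimately show ?thesis using low unfolding A_def by blast
    qed
  qed
  then obtain q where q: "sublinear q" "q \<le> p"
    and min: "\<And>r. sublinear r \<Longrightarrow> r \<le> q \<Longrightarrow> r = q"
    unfolding A_def by (metis (mono_tags, lifting) mem_Collect_eq order_trans)
  have minus: "q (- y) = - q y" for y
  proof -
    define r where "r = (\<lambda>x. INF t\<in>{0..}. q (x + t *\<^sub>R y) - t * q y)"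
    have ge: "- q (- x) \<le> q (x + t *\<^sub>R y) - t * q y" if "0 \<le> t" for x and t :: real
      using sublinear_add[OF q(1), of "- x" "x + t *\<^sub>R y"] sublinear_scale[OF q(1) that, of y] by simp
    have bdd: "bdd_below ((\<lambda>t. q (x + t *\<^sub>R y) - t * q y) ` {0..})" for x
      by (rule bdd_belowI2[where m = "- q (- x)"]) (use ge in simp)
    have low: "r x \<le> q (x + t *\<^sub>R y) - t * q y" if "0 \<le> t" for x and t :: real
      unfolding r_def by (rule cINF_lower[OF bdd]) (use that in simp)
    have great: "c \<le> r x" if "\<And>t. 0 \<le> t \<Longrightarrow> c \<le> q (x + t *\<^sub>R y) - t * q y" for c x
      unfolding r_def by (rule cINF_greatest) (use that in auto)
    have "sublinear r"
    proof (rule sublinearI)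
      fix x x'
      have "r (x + x') - (q (x' + t' *\<^sub>R y) - t' * q y) \<le> r x" if "0 \<le> t'" for t'
      proof (rule great)
        fix t :: real assume "0 \<le> t"
        have "r (x + x') \<le> q ((x + t *\<^sub>R y) + (x' + t' *\<^sub>R y)) - (t + t') * q y"
          using low[of "t + t'" "x + x'"] that \<open>0 \<le> t\<close> by (simp add: algebra_simps)
        then show "r (x + x') - (q (x' + t' *\<^sub>R y) - t' * q y) \<le> q (x + t *\<^sub>R y) - t * q y"
          using sublinear_add[OF q(1), of "x + t *\<^sub>R y" "x' + t' *\<^sub>R y"] by (simp add: algebra_simps)
      qed
      then have "r (x + x') - r x \<le> r x'"
        by (intro great) (simp add: algebra_simps)
      then show "r (x + x') \<le> r x + r x'" by simp
    next
      have "r 0 \<le> 0" using low[of 0 0] sublinear_zero[OF q(1)] by simp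
      moreover have "0 \<le> r 0"
        by (rule great) (use sublinear_scale[OF q(1)] in simp)
      ultimately show "r 0 = 0" by simp
    next
      fix s :: real and x assume s: "0 < s"
      have "inverse s * r (s *\<^sub>R x) \<le> r x"
      proof (rule great)
        fix t :: real assume t: "0 \<le> t"
        have "r (s *\<^sub>R x) \<le> q (s *\<^sub>R x + (s * t) *\<^sub>R y) - (s * t) * q y"
          using low[of "s * t" "s *\<^sub>R x"] s t by simp
        also have "s *\<^sub>R x + (s * t) *\<^sub>R y = s *\<^sub>R (x + t *\<^sub>R y)"
          by (simp add: algebra_simps)
        also have "q (s *\<^sub>R (x + t *\<^sub>R y)) = s * q (x + t *\<^sub>R y)"
          using s by (simp add: sublinear_scale[OF q(1)])
        finally show "inverse s * r (s *\<^sub>R x) \<le> q (x + t *\<^sub>R y) - t * q y"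
          using s by (simp add: field_simps)
      qed
      then show "r (s *\<^sub>R x) \<le> s * r x" using s by (simp add: field_simps)
    qed
    moreover have "r \<le> q" using low[of 0] by (simp add: le_fun_def)
    ultimately have "r = q" by (rule min)
    then have "q (- y) \<le> - q y"
      using low[of 1 "- y"] sublinear_zero[OF q(1)] by simp
    moreover have "- q y \<le> q (- y)" using sublinear_minus_le[OF q(1), of "- y"] by simp
    ultimately show ?thesis by simp
  qed
  have "linear q"
  proof (rule linearI)
    fix x y
    have "q x \<le> q (x + y) - q y"
      using sublinear_add[OF q(1), of "x + y" "- y"] by (simp add: minus)
    then show "q (x + y) = q x + q y" using sublinear_add[OF q(1), of x y] by simp
  next
    fix t :: real and x
    show "q (t *\<^sub>R x) = t *\<^sub>R q x"
    proof (cases "0 \<le> t")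
      case True then show ?thesis by (simp add: sublinear_scale[OF q(1)])
    next
      case False
      then have "q ((- t) *\<^sub>R x) = (- t) * q x" by (intro sublinear_scale[OF q(1)]) simp
      then show ?thesis by (simp add: minus)
    qed
  qed
  then show ?thesis using that q(2) by (simp add: le_fun_def)
qed

text \<open>Hahn-Banach for the functional \<open>p\<close> below: the choice \<open>t = 0\<close>
  shows \<open>p \<le> norm\<close>, and \<open>t = 1\<close> shows
  \<open>p (- s) \<le> - d\<close>, so a linear \<open>f \<le> p\<close> has both required
  properties. The distance hypothesis keeps the infimum above \<open>- norm x\<close>; convexity
  makes \<open>p\<close> subadditive.\<close>

theorem functional_separates_convex:
  fixes S :: "'v::real_normed_vector set"
  assumes "convex S" "S \<noteq> {}" and d: "\<And>s. s \<in> S \<Longrightarrow> d \<le> norm s"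
  obtains f :: "'v \<Rightarrow> real" where "bounded_linear f" "\<And>x. \<bar>f x\<bar> \<le> norm x" "\<And>s. s \<in> S \<Longrightarrow> d \<le> f s"
proof -
  define I where "I = {0::real..} \<times> S"
  define p where "p = (\<lambda>x. INF (t, s)\<in>I. norm (x + t *\<^sub>R s) - t * d)"
  have I: "I \<noteq> {}" using \<open>S \<noteq> {}\<close> by (auto simp: I_def)
  have ge: "- norm x \<le> norm (x + t *\<^sub>R s) - t * d" if "0 \<le> t" "s \<in> S" for x t s
  proof -
    have "t * d \<le> norm (t *\<^sub>R s)" using d[OF that(2)] that(1) by (simp add: mult_left_mono)
    also have "\<dots> \<le> norm (x + t *\<^sub>R s) + norm x"
      using norm_triangle_ineq4[of "x + t *\<^sub>R s" x] by simp
    finally show ?thesis by simp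
  qed
  have bdd: "bdd_below ((\<lambda>(t, s). norm (x + t *\<^sub>R s) - t * d) ` I)" for x
    by (rule bdd_belowI2[where m = "- norm x"]) (use ge in \<open>auto simp: I_def\<close>)
  have low: "p x \<le> norm (x + t *\<^sub>R s) - t * d" if "0 \<le> t" "s \<in> S" for x t s
    using cINF_lower[OF bdd, of "(t, s)" x] that by (simp add: I_def p_def)
  have great: "c \<le> p x" if "\<And>t s. 0 \<le> t \<Longrightarrow> s \<in> S \<Longrightarrow> c \<le> norm (x + t *\<^sub>R s) - t * d" for c x
    unfolding p_def by (rule cINF_greatest[OF I]) (use that in \<open>auto simp: I_def\<close>)
  obtain s0 where s0: "s0 \<in> S" using \<open>S \<noteq> {}\<close> by blast
  have "sublinear p"
  proof (rule sublinearI)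
    fix x y
    have *: "p (x + y) \<le> (norm (x + t *\<^sub>R s) - t * d) + (norm (y + t' *\<^sub>R s') - t' * d)"
      if t: "0 \<le> t" "0 \<le> t'" and s: "s \<in> S" "s' \<in> S" for t t' s s'
    proof -
      \<comment> \<open>Convexity merges the two parameter pairs into one. If both factors vanish,
        any point of \<open>S\<close> serves, here \<open>s0\<close>.\<close>
      obtain s'' where s'': "s'' \<in> S" "(t + t') *\<^sub>R s'' = t *\<^sub>R s + t' *\<^sub>R s'"
      proof (cases "t + t' = 0")
        case True
        then have "t = 0" "t' = 0" using t by auto
        then show ?thesis using that s0 by simp
      next
        case False
        have "(t / (t + t')) *\<^sub>R s + (t' / (t + t')) *\<^sub>R s' \<in> S"
          by (rule convexD[OF \<open>convex S\<close>])
             (use s t False in \<open>auto simp: add_divide_distrib[symmetric]\<close>)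
        then show ?thesis using that False by (simp add: scaleR_right_distrib)
      qed
      have "p (x + y) \<le> norm (x + y + (t + t') *\<^sub>R s'') - (t + t') * d"
        using low[of "t + t'" s'' "x + y"] s'' t by auto
      also have "x + y + (t + t') *\<^sub>R s'' = (x + t *\<^sub>R s) + (y + t' *\<^sub>R s')"
        using s'' by simp
      finally show ?thesis
        using norm_triangle_ineq[of "x + t *\<^sub>R s" "y + t' *\<^sub>R s'"] by (simp add: algebra_simps)
    qed
    have "p (x + y) - (norm (y + t' *\<^sub>R s') - t' * d) \<le> p x" if "0 \<le> t'" "s' \<in> S" for t' s'
      by (rule great) (use *[OF _ that(1) _ that(2)] in \<open>fastforce simp: algebra_simps\<close>)
    then have "p (x + y) - p x \<le> p y" by (intro great) (simp add: algebra_simps)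
    then show "p (x + y) \<le> p x + p y" by simp
  next
    have "0 \<le> p 0" by (rule great) (use d in \<open>simp add: mult_left_mono\<close>)
    moreover have "p 0 \<le> 0" using low[of 0 s0 0] s0 by simp
    ultimately show "p 0 = 0" by simp
  next
    fix r :: real and x :: 'v assume r: "0 < r"
    have "inverse r * p (r *\<^sub>R x) \<le> p x"
    proof (rule great)
      fix t :: real and s assume t: "0 \<le> t" "s \<in> S"
      have "p (r *\<^sub>R x) \<le> norm (r *\<^sub>R x + (r * t) *\<^sub>R s) - (r * t) * d"
        by (rule low) (use r t in simp_all)
      also have "norm (r *\<^sub>R x + (r * t) *\<^sub>R s) = r * norm (x + t *\<^sub>R s)"
        using r norm_scaleR[of r "x + t *\<^sub>R s"] by (simp add: scaleR_right_distrib)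
      finally show "inverse r * p (r *\<^sub>R x) \<le> norm (x + t *\<^sub>R s) - t * d"
        using r by (simp add: field_simps)
    qed
    then show "p (r *\<^sub>R x) \<le> r * p x" using r by (simp add: field_simps)
  qed
  then obtain f :: "'v \<Rightarrow> real" where f: "linear f" "\<And>x. f x \<le> p x"
    by (rule linear_below_sublinear) blast
  have le: "f x \<le> norm x" for x
    using f(2)[of x] low[of 0 s0 x] s0 by simp
  have abs: "\<bar>f x\<bar> \<le> norm x" for x
    using le[of x] le[of "- x"] linear_neg[OF f(1), of x] by simp
  have "bounded_linear f"
    using f(1) abs by (intro bounded_linear.intro linear_linear[THEN iffD1] bounded_linear_axioms.intro exI[of _ 1])
      (auto simp: linear_iff)
  moreover have "d \<le> f s" if "s \<in> S" for s
    using f(2)[of "- s"] low[of 1 s "- s"] that linear_neg[OF f(1), of s] by simp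
  ultimately show ?thesis using that abs by blast
qed

corollary norming_functional:
  fixes x :: "'v::real_normed_vector"
  obtains f :: "'v \<Rightarrow> real" where "bounded_linear f" "\<And>y. \<bar>f y\<bar> \<le> norm y" "f x = norm x"
proof -
  obtain f :: "'v \<Rightarrow> real" where f: "bounded_linear f" "\<And>y. \<bar>f y\<bar> \<le> norm y" "norm x \<le> f x"
    by (rule functional_separates_convex[of "{x}" "norm x"]) auto
  have "f x = norm x" using f(2)[of x] f(3) by linarith
  with f that show ?thesis by blast
qed

section \<open>Uniform boundedness\<close>

text \<open>Stated for seminorms because it is applied both to points of a set, acting on the dual
  space, and to a family of operators. Baire's theorem yields a ball on which one integer bounds all
  \<open>p i\<close>; scaling turns this into a linear bound.\<close>

theorem uniform_boundedness:
  fixes p :: "'i \<Rightarrow> 'x::banach \<Rightarrow> real"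
  assumes cont: "\<And>i. i \<in> I \<Longrightarrow> continuous_on UNIV (p i)"
    and add: "\<And>i x y. i \<in> I \<Longrightarrow> p i (x + y) \<le> p i x + p i y"
    and scale: "\<And>i t x. i \<in> I \<Longrightarrow> p i (t *\<^sub>R x) = \<bar>t\<bar> * p i x"
    and bound: "\<And>x. \<exists>B. \<forall>i\<in>I. p i x \<le> B"
  obtains M where "0 < M" "\<And>i x. i \<in> I \<Longrightarrow> p i x \<le> M * norm x"
proof -
  define F where "F n = {x. \<forall>i\<in>I. p i x \<le> real n}" for n
  have closed: "closed (F n)" for n
  proof -
    have "F n = (\<Inter>i\<in>I. {x. p i x \<le> real n})" by (auto simp: F_def)
    then show ?thesis using cont by (auto intro!: closed_INT closed_Collect_le continuous_intros)
  qed
  have "\<exists>n. interior (F n) \<noteq> {}"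
  proof (rule ccontr)
    assume "\<nexists>n. interior (F n) \<noteq> {}"
    then have "euclidean interior_of \<Union>(range F) = {}"
      using closed by (intro Baire_category_alt) (auto intro: completely_metrizable_space_euclidean)
    moreover have "\<Union>(range F) = UNIV"
    proof -
      have "\<exists>n. x \<in> F n" for x
      proof -
        obtain B where "\<forall>i\<in>I. p i x \<le> B" using bound by blast
        then show ?thesis unfolding F_def using real_nat_ceiling_ge[of B] by (force intro: order_trans)
      qed
      then show ?thesis by blast
    qed
    ultimately show False by simp
  qed
  then obtain n x0 e where e: "0 < e" "cball x0 e \<subseteq> F n"
    by (metis equals0I mem_interior_cball)
  \<comment> \<open>Two values on the ball, each at most \<open>n\<close>, bound \<open>p i\<close>
    at a difference of length \<open>e\<close>. The extra 1 makes the constant positive even for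
    \<open>n = 0\<close>.\<close>
  have "p i x \<le> (2 * real n + 1) / e * norm x" if i: "i \<in> I" for i x
  proof (cases "x = 0")
    case True
    then show ?thesis using scale[OF i, of 0 0] by simp
  next
    case False
    define y where "y = (e / norm x) *\<^sub>R x"
    have "norm y = e" using False e by (simp add: y_def)
    then have "x0 + y \<in> F n" "x0 \<in> F n" using e by (auto simp: dist_norm subset_iff)
    then have "p i (x0 + y) \<le> real n" "p i x0 \<le> real n" using i by (auto simp: F_def)
    moreover have "p i y \<le> p i (x0 + y) + p i x0"
      using add[OF i, of "x0 + y" "- x0"] scale[OF i, of "-1" x0] by simp
    ultimately have "p i y \<le> 2 * real n + 1" by simp
    moreover have "p i y = e / norm x * p i x" using e by (simp add: y_def scale[OF i])
    ultimately show ?thesis using False e by (simp add: field_simps)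
  qed
  with that[of "(2 * real n + 1) / e"] e show ?thesis by (simp add: divide_pos_pos)
qed

section \<open>Minimal closed sets\<close>

text \<open>A nonempty finite subfamily of a chain has a smallest member, which gives the finite
  intersection property.\<close>

lemma compactin_chain_Inter_nonempty:
  assumes K: "compactin X K" and "\<C> \<noteq> {}"
    and C: "\<And>C. C \<in> \<C> \<Longrightarrow> closedin X C \<and> C \<subseteq> K \<and> C \<noteq> {}"
    and chain: "\<And>C D. C \<in> \<C> \<Longrightarrow> D \<in> \<C> \<Longrightarrow> C \<subseteq> D \<or> D \<subseteq> C"
  shows "\<Inter>\<C> \<noteq> {}"
proof -
  have "K \<inter> \<Inter>\<F> \<noteq> {}" if F: "finite \<F>" "\<F> \<subseteq> \<C>" for \<F>
  proof (cases "\<F> = {}")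
    case True
    then show ?thesis using \<open>\<C> \<noteq> {}\<close> C by fastforce
  next
    case False
    obtain m where m: "m \<in> \<F>" "\<And>D. D \<in> \<F> \<Longrightarrow> D \<subseteq> m \<Longrightarrow> m = D"
      using finite_has_minimal[OF F(1) False] by blast
    then have "m \<subseteq> D" if "D \<in> \<F>" for D using chain[of m D] that F by blast
    then have "m \<subseteq> K \<inter> \<Inter>\<F>" using C m F by blast
    then show ?thesis using C m F by blast
  qed
  then have "K \<inter> \<Inter>\<C> \<noteq> {}" using K[unfolded compactin_fip, THEN conjunct2, rule_format, of \<C>] C by simp
  then show ?thesis by blast
qed

text \<open>Zorn's lemma, with \<open>P\<close> left abstract since it is used for weakly closed
  invariant sets and again for norm closed convex invariant sets.\<close>

lemma exists_minimal_closedin: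
  assumes K: "compactin X K" "closedin X K" "K \<noteq> {}" "P K"
    and Inter: "\<And>\<C>. \<C> \<noteq> {} \<Longrightarrow> (\<And>C. C \<in> \<C> \<Longrightarrow> P C) \<Longrightarrow> P (\<Inter>\<C>)"
  shows "\<exists>M\<subseteq>K. closedin X M \<and> M \<noteq> {} \<and> P M \<and>
    (\<forall>M'\<subseteq>M. closedin X M' \<longrightarrow> M' \<noteq> {} \<longrightarrow> P M' \<longrightarrow> M' = M)"
proof -
  define A where "A = {M. M \<subseteq> K \<and> closedin X M \<and> M \<noteq> {} \<and> P M}"
  have "\<exists>m\<in>A. \<forall>a\<in>A. a \<subseteq> m \<longrightarrow> a = m"
  proof (rule predicate_Zorn[of A "\<lambda>x y. y \<subseteq> x"])
    show "partial_order_on A (relation_of (\<lambda>x y. y \<subseteq> x) A)"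
      by (rule partial_order_on_relation_ofI) auto
    fix \<C> assume "\<C> \<in> Chains (relation_of (\<lambda>x y. y \<subseteq> x) A)"
    then have CA: "\<And>q. q \<in> \<C> \<Longrightarrow> q \<in> A"
      and chain: "\<And>q q'. q \<in> \<C> \<Longrightarrow> q' \<in> \<C> \<Longrightarrow> q \<subseteq> q' \<or> q' \<subseteq> q"
      by (auto simp: Chains_def relation_of_def)
    show "\<exists>u\<in>A. \<forall>a\<in>\<C>. u \<subseteq> a"
    proof (cases "\<C> = {}")
      case True
      then show ?thesis using K by (auto simp: A_def)
    next
      case False
      have "\<Inter>\<C> \<noteq> {}"
        by (rule compactin_chain_Inter_nonempty[OF K(1) False _ chain]) (use CA in \<open>auto simp: A_def\<close>)
      moreover have "\<Inter>\<C> \<subseteq> K" "closedin X (\<Inter>\<C>)" "P (\<Inter>\<C>)"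
        using False CA Inter[of \<C>] closedin_Inter[of \<C> X] by (auto simp: A_def)
      ultimately show ?thesis by (intro bexI[of _ "\<Inter>\<C>"]) (auto simp: A_def)
    qed
  qed
  then obtain M where M: "M \<in> A" "\<forall>a\<in>A. a \<subseteq> M \<longrightarrow> a = M" by blast
  have "M' = M" if "M' \<subseteq> M" "closedin X M'" "M' \<noteq> {}" "P M'" for M'
    using M that unfolding A_def by blast
  then show ?thesis using M(1) unfolding A_def by blast
qed

section \<open>Weakly compact sets\<close>

text \<open>These properties of the weak topology suffice; they mention only real functionals, so that the
  scalar field plays no role until the weak topology is shown to have them.\<close>

locale weak_like_topology =
  fixes W :: "'v::banach topology"
  assumes topspace_W: "topspace W = UNIV"
    and continuous_functional:
      "bounded_linear (f :: 'v \<Rightarrow> real) \<Longrightarrow> continuous_map W euclideanreal f"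
    and openin_imp_open: "openin W U \<Longrightarrow> open U"
begin

lemma openin_less: "bounded_linear (f :: 'v \<Rightarrow> real) \<Longrightarrow> openin W {x. f x < a}"
  using openin_continuous_map_preimage[OF continuous_functional, of f "{..<a}"]
  by (simp add: topspace_W)

lemma openin_greater: "bounded_linear (f :: 'v \<Rightarrow> real) \<Longrightarrow> openin W {x. a < f x}"
  using openin_continuous_map_preimage[OF continuous_functional, of f "{a<..}"]
  by (simp add: topspace_W)

lemma closedin_le: "bounded_linear (f :: 'v \<Rightarrow> real) \<Longrightarrow> closedin W {x. f x \<le> a}"
  using closedin_continuous_map_preimage[OF continuous_functional, of f "{..a}"]
  by (simp add: topspace_W)

lemma closedin_ge: "bounded_linear (f :: 'v \<Rightarrow> real) \<Longrightarrow> closedin W {x. a \<le> f x}"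
  using closedin_continuous_map_preimage[OF continuous_functional, of f "{a..}"]
  by (simp add: topspace_W)

lemma closedin_imp_closed: "closedin W C \<Longrightarrow> closed C"
  using openin_imp_open[of "- C"] by (simp add: closedin_def topspace_W closed_def Compl_eq_Diff_UNIV)

text \<open>Mazur's theorem. The set \<open>C - x\<close> keeps distance \<open>d\<close> from 0, so
  some functional is at least \<open>f x + d\<close> on \<open>C\<close>, and an open half-space
  around \<open>x\<close> misses \<open>C\<close>.\<close>

lemma closedin_convex:
  assumes C: "closed C" "convex C"
  shows "closedin W C"
proof -
  have "\<exists>U. openin W U \<and> x \<in> U \<and> U \<subseteq> - C" if x: "x \<notin> C" for x
  proof (cases "C = {}")
    case True
    then show ?thesis using openin_topspace[of W] topspace_W by auto
  next
    case False
    obtain d where d: "0 < d" "\<And>y. dist y x < d \<Longrightarrow> y \<notin> C"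
      using C(1) x open_dist[of "- C"] by auto
    have "d \<le> norm s" if "s \<in> (\<lambda>c. c - x) ` C" for s
      using that d(2) by (force simp: dist_norm not_less)
    moreover have "convex ((\<lambda>c. c - x) ` C)"
      using convex_translation_subtract[OF C(2), of x] by simp
    ultimately obtain f :: "'v \<Rightarrow> real" where f: "bounded_linear f" "\<And>s. s \<in> (\<lambda>c. c - x) ` C \<Longrightarrow> d \<le> f s"
      using functional_separates_convex[of "(\<lambda>c. c - x) ` C" d thesis] False by simp
    have "f c \<ge> f x + d" if "c \<in> C" for c
      using f(2)[of "c - x"] that linear_diff[OF bounded_linear.linear[OF f(1)], of c x] by auto
    then show ?thesis using d(1)
      by (intro exI[of _ "{y. f y < f x + d}"]) (force simp: openin_less f(1) not_less)
  qed
  then have "openin W (- C)" by (subst openin_subopen) auto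
  then show ?thesis by (simp add: closedin_def topspace_W Compl_eq_Diff_UNIV)
qed

text \<open>Points of \<open>K\<close> are regarded as functionals on the dual space. They are
  pointwise bounded there, since functionals have compact image on \<open>K\<close>, and a norming
  functional turns the resulting uniform bound into a bound on the norm.\<close>

lemma compactin_imp_bounded:
  assumes K: "compactin W K"
  obtains B where "0 < B" "\<And>x. x \<in> K \<Longrightarrow> norm x \<le> B"
proof -
  have "\<exists>B. \<forall>x\<in>K. \<bar>blinfun_apply f x\<bar> \<le> B" for f :: "'v \<Rightarrow>\<^sub>L real"
  proof -
    have "compactin euclideanreal (blinfun_apply f ` K)"
      by (rule image_compactin[OF K continuous_functional]) (rule blinfun.bounded_linear_right)
    then have "bounded (blinfun_apply f ` K)" by (simp add: compact_imp_bounded)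
    then show ?thesis by (auto simp: bounded_iff)
  qed
  then obtain M where M: "0 < M" "\<And>x f. x \<in> K \<Longrightarrow> \<bar>blinfun_apply f x\<bar> \<le> M * norm f"
    by (rule uniform_boundedness[of K "\<lambda>x (f :: 'v \<Rightarrow>\<^sub>L real). \<bar>blinfun_apply f x\<bar>", rotated 3])
      (auto intro!: continuous_intros simp: blinfun.add_left blinfun.scaleR_left abs_mult)
  have "norm x \<le> M" if x: "x \<in> K" for x
  proof -
    obtain f :: "'v \<Rightarrow> real" where f: "bounded_linear f" "\<And>y. \<bar>f y\<bar> \<le> norm y" "f x = norm x"
      by (rule norming_functional[of x]) blast
    have "norm (Blinfun f) \<le> 1"
      by (rule norm_blinfun_bound) (use f in \<open>auto simp: bounded_linear_Blinfun_apply\<close>)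
    then have "M * norm (Blinfun f) \<le> M" using M(1) by simp
    then show ?thesis
      using M(2)[OF x, of "Blinfun f"] f by (simp add: bounded_linear_Blinfun_apply)
  qed
  with M(1) that show ?thesis by blast
qed

end

text \<open>\<open>E\<close> is the rational span of \<open>D\<close>, parametrized by finite lists
  so that it is visibly countable. Its closure is convex because real coefficients are limits of
  rational ones.\<close>

lemma countable_imp_separable_convex:
  fixes D :: "'v::real_normed_vector set"
  assumes "countable D"
  obtains E where "countable E" "D \<subseteq> closure E" "convex (closure E)"
proof -
  define g where "g = (\<lambda>l. sum_list (map (\<lambda>(q, d). q *\<^sub>R d) l) :: 'v)"
  define E where "E = g ` lists (\<rat> \<times> D)"
  have E: "countable E" unfolding E_def using assms by (simp add: countable_rat)
  have g: "g (l @ l') = g l + g l'" for l l' by (simp add: g_def)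
  have add: "x + y \<in> E" if xy: "x \<in> E" "y \<in> E" for x y
  proof -
    obtain l l' where "l \<in> lists (\<rat> \<times> D)" "l' \<in> lists (\<rat> \<times> D)" "x = g l" "y = g l'"
      using xy unfolding E_def by (elim imageE) blast
    then show ?thesis unfolding E_def by (intro image_eqI[of _ _ "l @ l'"]) (auto simp: g)
  qed
  have scale: "q *\<^sub>R x \<in> E" if qx: "q \<in> \<rat>" "x \<in> E" for q x
  proof -
    obtain l where l: "l \<in> lists (\<rat> \<times> D)" "x = g l" using qx by (auto simp: E_def)
    have "q *\<^sub>R g l = g (map (\<lambda>(r, d). (q * r, d)) l)"
      by (induction l) (auto simp: g_def scaleR_right_distrib)
    moreover have "map (\<lambda>(r, d). (q * r, d)) l \<in> lists (\<rat> \<times> D)"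
      using l(1) qx(1) by (induction l) auto
    ultimately show ?thesis using l(2) E_def by blast
  qed
  have "convex (closure E)"
  proof (rule convexI)
    fix x y and u v :: real assume "x \<in> closure E" "y \<in> closure E"
    then obtain a b where a: "\<And>n. a n \<in> E" "a \<longlonglongrightarrow> x" and b: "\<And>n. b n \<in> E" "b \<longlonglongrightarrow> y"
      by (auto simp: closure_sequential)
    have "u \<in> closure \<rat>" "v \<in> closure \<rat>" by (simp_all add: Rats_closure_real)
    then obtain p q where p: "\<And>n. p n \<in> \<rat>" "p \<longlonglongrightarrow> u" and q: "\<And>n. q n \<in> \<rat>" "q \<longlonglongrightarrow> v"
      by (auto simp: closure_sequential)
    show "u *\<^sub>R x + v *\<^sub>R y \<in> closure E"
      unfolding closure_sequential
      by (rule exI[of _ "\<lambda>n. p n *\<^sub>R a n + q n *\<^sub>R b n"])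
        (intro conjI allI add scale a b p q tendsto_intros)
  qed
  moreover have "D \<subseteq> E"
  proof
    fix d assume "d \<in> D"
    then show "d \<in> E" unfolding E_def by (intro image_eqI[of _ _ "[(1, d)]"]) (auto simp: g_def)
  qed
  ultimately show ?thesis using that[OF E] closure_subset by blast
qed

lemma uncountable_nat_bool: "uncountable (UNIV :: (nat \<Rightarrow> bool) set)"
proof
  assume "countable (UNIV :: (nat \<Rightarrow> bool) set)"
  then obtain e :: "nat \<Rightarrow> nat \<Rightarrow> bool" where "range e = UNIV"
    using uncountable_def[of "UNIV :: (nat \<Rightarrow> bool) set"] by blast
  then obtain n where "e n = (\<lambda>k. \<not> e k k)" by (metis UNIV_I imageE)
  then show False by (metis (full_types))
qed

context weak_like_topology
begin

text \<open>Otherwise every relatively open piece of \<open>K\<close> could be split by a functional into two pieces at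
  distance \<open>\<epsilon>\<close>; the branches of the resulting binary tree give uncountably many points at mutual
  distance \<open>\<epsilon>\<close> in the closed convex hull of a countable set, which is separable.\<close>

theorem weakly_compact_small_piece:
  assumes K: "compactin W K" "closedin W K" "K \<noteq> {}" and \<epsilon>: "0 < \<epsilon>"
  obtains U where "openin W U" "U \<inter> K \<noteq> {}" "\<And>x y. x \<in> U \<inter> K \<Longrightarrow> y \<in> U \<inter> K \<Longrightarrow> norm (x - y) \<le> \<epsilon>"
proof -
  have False if none: "\<And>U. openin W U \<Longrightarrow> U \<inter> K \<noteq> {} \<Longrightarrow> \<exists>x\<in>U\<inter>K. \<exists>y\<in>U\<inter>K. \<epsilon> < norm (x - y)"
  proof -
    define P where "P U f a b \<longleftrightarrow> bounded_linear (f :: 'v \<Rightarrow> real) \<and> (\<forall>x. \<bar>f x\<bar> \<le> norm x) \<and> a + \<epsilon> \<le> b \<and>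
       U \<inter> {x. f x < a} \<inter> K \<noteq> {} \<and> U \<inter> {x. b < f x} \<inter> K \<noteq> {}" for U f a b
    have "\<exists>f a b. P U f a b"
      if U: "openin W U \<and> U \<inter> K \<noteq> {}" for U
    proof -
      obtain x y where xy: "x \<in> U \<inter> K" "y \<in> U \<inter> K" "\<epsilon> < norm (x - y)" using none U by blast
      obtain f :: "'v \<Rightarrow> real" where f: "bounded_linear f" "\<And>z. \<bar>f z\<bar> \<le> norm z" "f (x - y) = norm (x - y)"
        by (rule norming_functional[of "x - y"]) blast
      have "f x - f y = norm (x - y)" using f(3) linear_diff[OF bounded_linear.linear[OF f(1)]] by simp
      \<comment> \<open>Half of the excess over \<epsilon>: moving both thresholds inward by
        \<open>h\<close> makes the inequalities strict at \<open>x\<close> and \<open>y\<close> and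
        leaves a gap of exactly \<epsilon>.\<close>
      define h where "h = (norm (x - y) - \<epsilon>) / 2"
      have h: "0 < h" "f y + h + \<epsilon> = f x - h"
        using xy(3) \<open>f x - f y = norm (x - y)\<close> by (auto simp: h_def field_simps)
      show ?thesis unfolding P_def
        by (rule exI[of _ f], rule exI[of _ "f y + h"], rule exI[of _ "f x - h"])
          (use xy f h in auto)
    qed
    then obtain f a b where "\<And>U. openin W U \<and> U \<inter> K \<noteq> {} \<Longrightarrow> P U (f U) (a U) (b U)"
      by metis
    then have fab: "\<And>U. openin W U \<and> U \<inter> K \<noteq> {} \<Longrightarrow> bounded_linear (f U) \<and>
       (\<forall>x. \<bar>f U x\<bar> \<le> norm x) \<and> a U + \<epsilon> \<le> b U \<and>
       U \<inter> {x. f U x < a U} \<inter> K \<noteq> {} \<and> U \<inter> {x. b U < f U x} \<inter> K \<noteq> {}" for U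
      unfolding P_def by blast
    \<comment> \<open>\<open>H\<close> keeps the low side of the split for \<open>True\<close> and
      the high side for \<open>False\<close>. In \<open>T\<close>, the head of the word is the most
      recent choice.\<close>
    define H where "H = (\<lambda>c U. U \<inter> (if c then {x. f U x < a U} else {x. b U < f U x}))"
    define T where "T = (\<lambda>\<sigma>. foldr H \<sigma> UNIV)"
    have T_Cons: "T (c # \<sigma>) = H c (T \<sigma>)" for c \<sigma> by (simp add: T_def)
    have T: "openin W (T \<sigma>) \<and> T \<sigma> \<inter> K \<noteq> {}" for \<sigma>
    proof (induction \<sigma>)
      case Nil
      then show ?case using openin_topspace[of W] topspace_W K by (simp add: T_def)
    next
      case (Cons c \<sigma>)
      with fab[OF Cons] show ?case
        unfolding T_Cons H_def by (cases c) (auto intro!: openin_Int openin_less openin_greater)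
    qed
    then have "\<forall>\<sigma>. \<exists>x. x \<in> T \<sigma> \<inter> K" by blast
    from choice[OF this] obtain x where "\<forall>\<sigma>. x \<sigma> \<in> T \<sigma> \<inter> K" ..
    then have x: "x \<sigma> \<in> T \<sigma> \<inter> K" for \<sigma> ..
    obtain E where E: "countable E" "range x \<subseteq> closure E" "convex (closure E)"
      by (rule countable_imp_separable_convex[of "range x"]) auto
    have clE: "closedin W (closure E)" by (intro closedin_convex E) simp
    \<comment> \<open>The first \<open>n\<close> choices of the branch, latest first, to match the
      order of words in \<open>T\<close>.\<close>
    define pre where "pre = (\<lambda>\<beta> n. rec_nat [] (\<lambda>n l. \<beta> n # l) n :: bool list)"
    have pre: "pre \<beta> 0 = []" "pre \<beta> (Suc n) = \<beta> n # pre \<beta> n" for \<beta> n by (simp_all add: pre_def)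
    have mono: "T (pre \<beta> m) \<subseteq> T (pre \<beta> n)" if "n \<le> m" for \<beta> n m
      using that by (induction rule: dec_induct) (auto simp: pre T_Cons H_def)
    \<comment> \<open>A common point of these closed tails is a weak cluster point of the branch. It
      lies in every closed half-space that the branch eventually enters, so the strict inequalities
      survive as weak ones.\<close>
    define A where "A = (\<lambda>\<beta> n. W closure_of ((\<lambda>m. x (pre \<beta> m)) ` {n..}))"
    have "\<exists>p. p \<in> (\<Inter>n. A \<beta> n)" for \<beta>
    proof -
      have "\<Inter>(range (A \<beta>)) \<noteq> {}"
      proof (rule compactin_chain_Inter_nonempty[OF K(1)])
        fix C assume "C \<in> range (A \<beta>)"
        then obtain n where C: "C = A \<beta> n" by blast
        have "C \<subseteq> K" unfolding C A_def by (rule closure_of_minimal) (use x K in auto)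
        moreover have "x (pre \<beta> n) \<in> C" unfolding C A_def
          by (rule subsetD[OF closure_of_subset]) (auto simp: topspace_W)
        ultimately show "closedin W C \<and> C \<subseteq> K \<and> C \<noteq> {}" by (auto simp: C A_def)
      next
        have "A \<beta> n \<subseteq> A \<beta> m" if "m \<le> n" for m n
          unfolding A_def by (rule closure_of_mono) (use that in auto)
        then show "C \<subseteq> D \<or> D \<subseteq> C" if "C \<in> range (A \<beta>)" "D \<in> range (A \<beta>)" for C D
          using that by (metis imageE nat_le_linear)
      qed simp
      then show ?thesis by blast
    qed
    then obtain p where p: "\<And>\<beta> n. p \<beta> \<in> A \<beta> n" by (metis INT_E UNIV_I)
    have inE: "p \<beta> \<in> closure E" for \<beta>
    proof -
      have "A \<beta> 0 \<subseteq> closure E" unfolding A_def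
        by (rule closure_of_minimal) (use E(2) clE in auto)
      then show ?thesis using p by blast
    qed
    have lower: "f (T (pre \<beta> n)) (p \<beta>) \<le> a (T (pre \<beta> n))" if "\<beta> n" for \<beta> n
    proof -
      have "x (pre \<beta> m) \<in> {z. f (T (pre \<beta> n)) z \<le> a (T (pre \<beta> n))}" if "Suc n \<le> m" for m
        using x[of "pre \<beta> m"] mono[OF that, of \<beta>] \<open>\<beta> n\<close> by (auto simp: pre T_Cons H_def)
      then have "A \<beta> (Suc n) \<subseteq> {z. f (T (pre \<beta> n)) z \<le> a (T (pre \<beta> n))}"
        unfolding A_def using fab[OF T] by (intro closure_of_minimal closedin_le) auto
      then show ?thesis using p by blast
    qed
    have upper: "b (T (pre \<beta> n)) \<le> f (T (pre \<beta> n)) (p \<beta>)" if "\<not> \<beta> n" for \<beta> n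
    proof -
      have "x (pre \<beta> m) \<in> {z. b (T (pre \<beta> n)) \<le> f (T (pre \<beta> n)) z}" if "Suc n \<le> m" for m
        using x[of "pre \<beta> m"] mono[OF that, of \<beta>] \<open>\<not> \<beta> n\<close> by (auto simp: pre T_Cons H_def)
      then have "A \<beta> (Suc n) \<subseteq> {z. b (T (pre \<beta> n)) \<le> f (T (pre \<beta> n)) z}"
        unfolding A_def using fab[OF T] by (intro closure_of_minimal closedin_ge) auto
      then show ?thesis using p by blast
    qed
    have apart: "\<epsilon> \<le> norm (p \<beta> - p \<gamma>)" if n: "\<not> \<beta> n" "\<gamma> n" "pre \<beta> n = pre \<gamma> n" for \<beta> \<gamma> n
    proof -
      let ?U = "T (pre \<beta> n)"
      have *: "bounded_linear (f ?U)" "\<bar>f ?U (p \<beta> - p \<gamma>)\<bar> \<le> norm (p \<beta> - p \<gamma>)" "a ?U + \<epsilon> \<le> b ?U"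
        using fab[OF T[of "pre \<beta> n"]] by auto
      have "\<epsilon> \<le> f ?U (p \<beta>) - f ?U (p \<gamma>)"
        using upper[of \<beta> n] lower[of \<gamma> n] n *(3) by simp
      also have "\<dots> = f ?U (p \<beta> - p \<gamma>)" using linear_diff[OF bounded_linear.linear[OF *(1)]] by simp
      finally show ?thesis using *(2) by simp
    qed
    have sep: "\<epsilon> \<le> norm (p \<beta> - p \<gamma>)" if "\<beta> \<noteq> \<gamma>" for \<beta> \<gamma>
    proof -
      \<comment> \<open>Up to the first disagreement both branches pass through the same nodes. At
        that node they use the same functional but opposite sides of its gap.\<close>
      define n where "n = (LEAST n. \<beta> n \<noteq> \<gamma> n)"
      have n: "\<beta> n \<noteq> \<gamma> n" unfolding n_def by (rule LeastI_ex) (use that in \<open>auto simp: fun_eq_iff\<close>)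
      have eq: "\<beta> k = \<gamma> k" if "k < n" for k
        using not_less_Least[of k "\<lambda>n. \<beta> n \<noteq> \<gamma> n"] that by (simp add: n_def)
      have "pre \<beta> k = pre \<gamma> k" if "k \<le> n" for k
        using that by (induction k) (auto simp: pre eq)
      then have "pre \<beta> n = pre \<gamma> n" by simp
      then show ?thesis using n apart[of \<beta> n \<gamma>] apart[of \<gamma> n \<beta>] by (auto simp: norm_minus_commute)
    qed
    \<comment> \<open>Open balls of radius \<epsilon>/2 around points at mutual distance at least
      \<epsilon> are disjoint, so these choices embed all branches into the countable set
      \<open>E\<close>.\<close>
    have "\<exists>e\<in>E. norm (e - p \<beta>) < \<epsilon> / 2" for \<beta>
      using inE[of \<beta>] \<epsilon> unfolding closure_approachable dist_norm by (meson half_gt_zero)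
    then obtain e where e: "\<And>\<beta>. e \<beta> \<in> E" "\<And>\<beta>. norm (e \<beta> - p \<beta>) < \<epsilon> / 2" by metis
    have "inj e"
    proof (rule injI, rule ccontr)
      fix \<beta> \<gamma> assume "e \<beta> = e \<gamma>" "\<beta> \<noteq> \<gamma>"
      then have "norm (p \<beta> - p \<gamma>) < \<epsilon>"
        using e(2)[of \<beta>] e(2)[of \<gamma>] norm_triangle_ineq4[of "e \<beta> - p \<gamma>" "e \<beta> - p \<beta>"] by simp
      with sep[OF \<open>\<beta> \<noteq> \<gamma>\<close>] show False by simp
    qed
    moreover have "countable (range e)" by (rule countable_subset[OF _ E(1)]) (use e(1) in auto)
    ultimately show False using uncountable_nat_bool countable_image_inj_eq[of e UNIV] by simp
  qed
  then show ?thesis using that by (meson not_le)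
qed

end

section \<open>Groups of operators with relatively weakly compact orbits\<close>

text \<open>The hull of \<open>K\<close> stays within \<epsilon>/4 of the hull of a finite net,
  which is compact. Passing from the closure to the hull, then to the hull of the net, then to a net
  of that, costs less than \<epsilon>/4 each time.\<close>

lemma compact_closure_convex_hull:
  fixes K :: "'v::banach set"
  assumes "compact K"
  shows "compact (closure (convex hull K))"
  unfolding compact_eq_totally_bounded
proof (intro conjI allI impI)
  show "complete (closure (convex hull K))" by (simp add: complete_eq_closed)
  fix \<epsilon> :: real assume \<epsilon>: "0 < \<epsilon>"
  then have \<epsilon>4: "0 < \<epsilon> / 4" by simp
  obtain F where F: "finite F" "K \<subseteq> (\<Union>x\<in>F. ball x (\<epsilon> / 4))"
    using assms \<epsilon>4 unfolding compact_eq_totally_bounded by blast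
  have "compact (convex hull F)" using F(1) by (rule finite_imp_compact_convex_hull)
  then obtain N where N: "finite N" "convex hull F \<subseteq> (\<Union>x\<in>N. ball x (\<epsilon> / 4))"
    using \<epsilon>4 unfolding compact_eq_totally_bounded by blast
  define A where "A = (\<Union>x\<in>convex hull F. \<Union>y\<in>ball 0 (\<epsilon> / 4). {x + y})"
  have "convex A" unfolding A_def by (intro convex_sums convex_convex_hull convex_ball)
  moreover have "K \<subseteq> A"
  proof
    fix x assume "x \<in> K"
    then obtain z where z: "z \<in> F" "dist z x < \<epsilon> / 4" using F by auto
    then have "x = z + (x - z)" "z \<in> convex hull F" "x - z \<in> ball 0 (\<epsilon> / 4)"
      by (auto simp: dist_norm norm_minus_commute hull_inc)
    then show "x \<in> A" unfolding A_def by blast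
  qed
  ultimately have "convex hull K \<subseteq> A" by (rule hull_minimal[rotated])
  have "closure (convex hull K) \<subseteq> (\<Union>x\<in>N. ball x \<epsilon>)"
  proof
    fix x assume "x \<in> closure (convex hull K)"
    then obtain y where y: "y \<in> convex hull K" "dist y x < \<epsilon> / 4"
      using \<epsilon>4 unfolding closure_approachable by blast
    then obtain z w where zw: "z \<in> convex hull F" "norm w < \<epsilon> / 4" "y = z + w"
      using \<open>convex hull K \<subseteq> A\<close> by (auto simp: A_def)
    obtain u where u: "u \<in> N" "dist u z < \<epsilon> / 4" using N zw by auto
    have "dist z y < \<epsilon> / 4" using zw by (simp add: dist_norm)
    then have "dist u x < \<epsilon>"
      using u y dist_triangle[of u x z] dist_triangle[of z x y] \<epsilon> by linarith
    then show "x \<in> (\<Union>x\<in>N. ball x \<epsilon>)" using u by auto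
  qed
  then show "\<exists>k. finite k \<and> closure (convex hull K) \<subseteq> (\<Union>x\<in>k. ball x \<epsilon>)" using N(1) by blast
qed

text \<open>Generated by two-term mixing, so that any property of operators stable under such mixing
  follows by induction.\<close>

inductive_set averages :: "('v::real_vector \<Rightarrow> 'v) set \<Rightarrow> ('v \<Rightarrow> 'v) set" for S
  where
    base: "s \<in> S \<Longrightarrow> s \<in> averages S"
  | mix: "m \<in> averages S \<Longrightarrow> m' \<in> averages S \<Longrightarrow> 0 \<le> u \<Longrightarrow> 0 \<le> w \<Longrightarrow> u + w = 1 \<Longrightarrow>
      (\<lambda>v. u *\<^sub>R m v + w *\<^sub>R m' v) \<in> averages S"

text \<open>Abstracts \<open>\<rho>(C)\<close>: the ergodic theorem depends only on the operators,
  not on the group they come from.\<close>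

locale weakly_compact_group = weak_like_topology W for W :: "'v::banach topology" +
  fixes S :: "('v \<Rightarrow> 'v) set"
  assumes bounded_linear_op: "s \<in> S \<Longrightarrow> bounded_linear s"
    and continuous_op: "s \<in> S \<Longrightarrow> continuous_map W W s"
    and id_mem: "id \<in> S"
    and comp_mem: "s \<in> S \<Longrightarrow> t \<in> S \<Longrightarrow> s \<circ> t \<in> S"
    and inverse_mem: "s \<in> S \<Longrightarrow> \<exists>t\<in>S. t \<circ> s = id"
    and compactin_orbit: "compactin W (W closure_of ((\<lambda>s. s v) ` S))"
begin

lemma right_inverse:
  assumes "s \<in> S"
  obtains t where "t \<in> S" "\<And>v. s (t v) = v" "\<And>v. t (s v) = v"
proof -
  obtain t where t: "t \<in> S" "t \<circ> s = id" using inverse_mem assms by blast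
  obtain r where r: "r \<circ> t = id" using inverse_mem t(1) by blast
  have "r = s" by (metis comp_assoc comp_id id_comp r t(2))
  then show ?thesis using that t r by (metis comp_apply id_apply)
qed

text \<open>Each orbit is norm bounded as part of a weakly compact set; uniform boundedness does the
  rest. Taking \<open>M\<close> at least 1 allows division by it later.\<close>

lemma uniform_bound:
  obtains M where "1 \<le> M" "\<And>s v. s \<in> S \<Longrightarrow> norm (s v) \<le> M * norm v"
proof -
  have bdd: "\<exists>B. \<forall>s\<in>S. norm (s v) \<le> B" for v
  proof -
    obtain B where "\<And>x. x \<in> W closure_of ((\<lambda>s. s v) ` S) \<Longrightarrow> norm x \<le> B"
      using compactin_imp_bounded[OF compactin_orbit[of v]] by blast
    moreover have "(\<lambda>s. s v) ` S \<subseteq> W closure_of ((\<lambda>s. s v) ` S)"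
      by (rule closure_of_subset) (simp add: topspace_W)
    ultimately show ?thesis by blast
  qed
  obtain M where M: "\<And>s v. s \<in> S \<Longrightarrow> norm (s v) \<le> M * norm v"
  proof (rule uniform_boundedness[of S "\<lambda>s v. norm (s v)", OF _ _ _ bdd])
    fix s assume s: "s \<in> S"
    then interpret bounded_linear s by (rule bounded_linear_op)
    show "continuous_on UNIV (\<lambda>v. norm (s v))"
      by (intro continuous_on_norm linear_continuous_on bounded_linear_op s)
    show "norm (s (x + y)) \<le> norm (s x) + norm (s y)" for x y by (simp add: add norm_triangle_ineq)
    show "norm (s (t *\<^sub>R x)) = \<bar>t\<bar> * norm (s x)" for t x by (simp add: scaleR)
  qed blast
  have "norm (s v) \<le> max 1 M * norm v" if "s \<in> S" for s v
    using M[OF that, of v] mult_right_mono[of M "max 1 M" "norm v"] by simp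
  then show ?thesis using that[of "max 1 M"] by simp
qed

section \<open>An equivalent norm for which the operators are isometries\<close>

definition invariant_norm :: "'v \<Rightarrow> real"
  where "invariant_norm v = (SUP s\<in>S. norm (s v))"

lemma bdd_above_orbit: "bdd_above ((\<lambda>s. norm (s v)) ` S)"
  by (rule uniform_bound) (auto intro!: bdd_aboveI2)

lemma norm_op_le_invariant_norm: "s \<in> S \<Longrightarrow> norm (s v) \<le> invariant_norm v"
  unfolding invariant_norm_def by (rule cSUP_upper[OF _ bdd_above_orbit])

lemma invariant_norm_leI: "(\<And>s. s \<in> S \<Longrightarrow> norm (s v) \<le> B) \<Longrightarrow> invariant_norm v \<le> B"
  unfolding invariant_norm_def using id_mem by (intro cSUP_least) auto

lemma norm_le_invariant_norm: "norm v \<le> invariant_norm v"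
  using norm_op_le_invariant_norm[OF id_mem] by simp

lemma invariant_norm_op:
  assumes s: "s \<in> S"
  shows "invariant_norm (s v) = invariant_norm v"
proof (rule antisym)
  show "invariant_norm (s v) \<le> invariant_norm v"
    by (rule invariant_norm_leI) (use norm_op_le_invariant_norm[OF comp_mem[OF _ s]] in simp)
  obtain t where t: "t \<in> S" "\<And>v. t (s v) = v" using right_inverse[OF s] by metis
  show "invariant_norm v \<le> invariant_norm (s v)"
  proof (rule invariant_norm_leI)
    fix r assume "r \<in> S"
    then show "norm (r v) \<le> invariant_norm (s v)"
      using norm_op_le_invariant_norm[OF comp_mem[OF _ t(1)], of r "s v"] t(2) by simp
  qed
qed

lemma invariant_norm_triangle: "invariant_norm (v + w) \<le> invariant_norm v + invariant_norm w"
proof (rule invariant_norm_leI)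
  fix s assume s: "s \<in> S"
  have "norm (s (v + w)) \<le> norm (s v) + norm (s w)"
    using linear_add[OF bounded_linear.linear[OF bounded_linear_op[OF s]]] by (simp add: norm_triangle_ineq)
  then show "norm (s (v + w)) \<le> invariant_norm v + invariant_norm w"
    using norm_op_le_invariant_norm[OF s, of v] norm_op_le_invariant_norm[OF s, of w] by simp
qed

lemma invariant_norm_scale_le:
  assumes "0 \<le> c"
  shows "invariant_norm (c *\<^sub>R v) \<le> c * invariant_norm v"
proof (rule invariant_norm_leI)
  fix s assume s: "s \<in> S"
  have "norm (s (c *\<^sub>R v)) = c * norm (s v)"
    using linear_scale[OF bounded_linear.linear[OF bounded_linear_op[OF s]]] assms by simp
  then show "norm (s (c *\<^sub>R v)) \<le> c * invariant_norm v"
    using norm_op_le_invariant_norm[OF s, of v] assms by (simp add: mult_left_mono)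
qed

lemma invariant_norm_sum_le:
  "finite F \<Longrightarrow> invariant_norm (\<Sum>x\<in>F. f x) \<le> (\<Sum>x\<in>F. invariant_norm (f x))"
proof (induction F rule: finite_induct)
  case empty
  then show ?case using invariant_norm_scale_le[of 0 0] by simp
next
  case (insert x F)
  then show ?case using invariant_norm_triangle[of "f x" "\<Sum>x\<in>F. f x"] by simp
qed

lemma continuous_invariant_norm: "continuous_on A invariant_norm"
proof (rule uniform_bound)
  fix M :: real assume M: "1 \<le> M" "\<And>s v. s \<in> S \<Longrightarrow> norm (s v) \<le> M * norm v"
  have le: "invariant_norm v - invariant_norm w \<le> M * dist v w" for v w
  proof -
    have "invariant_norm v \<le> invariant_norm (v - w) + invariant_norm w"
      using invariant_norm_triangle[of "v - w" w] by simp
    moreover have "invariant_norm (v - w) \<le> M * dist v w"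
      by (rule invariant_norm_leI) (simp add: M dist_norm)
    ultimately show ?thesis by simp
  qed
  have "M-lipschitz_on A invariant_norm"
  proof (rule lipschitz_onI)
    fix v w show "dist (invariant_norm v) (invariant_norm w) \<le> M * dist v w"
      using le[of v w] le[of w v] by (simp add: dist_real_def dist_commute abs_le_iff)
  qed (use M in simp)
  then show ?thesis by (rule lipschitz_on_continuous_on)
qed

text \<open>Kakutani's argument: a minimal invariant compact convex set of positive diameter for the invariant
  norm contains a barycentre \<open>u\<close> whose distance to all its points is smaller than the diameter,
  and the points with this property form a smaller invariant set.\<close>

theorem compact_convex_fixed_point:
  assumes Q: "compact Q" "convex Q" "Q \<noteq> {}" and inv: "\<And>s. s \<in> S \<Longrightarrow> s ` Q \<subseteq> Q"
  obtains x where "x \<in> Q" "\<And>s. s \<in> S \<Longrightarrow> s x = x"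
proof -
  define P where "P R \<longleftrightarrow> convex R \<and> (\<forall>s\<in>S. s ` R \<subseteq> R)" for R
  have PQ: "compactin euclidean Q" "closedin euclidean Q" "P Q"
    using Q inv by (auto simp: P_def compact_imp_closed)
  have PInter: "P (\<Inter>\<C>)" if "\<C> \<noteq> {}" "\<And>C. C \<in> \<C> \<Longrightarrow> P C" for \<C>
    using that unfolding P_def by (fastforce intro: convex_Inter)
  obtain R where R: "R \<subseteq> Q" "closedin euclidean R" "R \<noteq> {}" "P R"
    and min: "\<And>R'. R' \<subseteq> R \<Longrightarrow> closedin euclidean R' \<Longrightarrow> R' \<noteq> {} \<Longrightarrow> P R' \<Longrightarrow> R' = R"
    using exists_minimal_closedin[of euclidean Q P, OF PQ(1,2) Q(3) PQ(3) PInter] by (metis (no_types))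
  have Rc: "compact R" using R Q by (metis closed_closedin compact_Int_closed inf.absorb2)
  have Rconv: "convex R" and Rinv: "\<And>s x. s \<in> S \<Longrightarrow> x \<in> R \<Longrightarrow> s x \<in> R"
    using R(4) by (auto simp: P_def)
  have cont: "continuous_on A (\<lambda>z. invariant_norm (fst z - snd z))" for A
    by (intro continuous_on_compose2[OF continuous_invariant_norm[of UNIV]] continuous_intros) auto
  have "R \<times> R \<noteq> {}" using R(3) by simp
  then obtain z where z: "z \<in> R \<times> R"
    "\<forall>w\<in>R \<times> R. invariant_norm (fst w - snd w) \<le> invariant_norm (fst z - snd z)"
    using continuous_attains_sup[OF compact_Times[OF Rc Rc] _ cont] by blast
  obtain a b where ab: "a \<in> R" "b \<in> R"
    and max: "\<And>x y. x \<in> R \<Longrightarrow> y \<in> R \<Longrightarrow> invariant_norm (x - y) \<le> invariant_norm (a - b)"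
  proof
    show "fst z \<in> R" "snd z \<in> R" using z(1) by auto
    show "invariant_norm (x - y) \<le> invariant_norm (fst z - snd z)" if "x \<in> R" "y \<in> R" for x y
      using z(2)[rule_format, of "(x, y)"] that by simp
  qed
  define d where "d = invariant_norm (a - b)"
  have "d \<le> 0"
  proof (rule ccontr)
    assume "\<not> d \<le> 0"
    then have d: "0 < d" by simp
    have op: "open {y. invariant_norm (y - x) < d / 2}" for x
      by (intro open_Collect_less continuous_on_compose2[OF continuous_invariant_norm[of UNIV]]
          continuous_intros) auto
    have "invariant_norm 0 = 0"
      using invariant_norm_scale_le[of 0 0] norm_le_invariant_norm[of 0] by simp
    then have "R \<subseteq> (\<Union>x\<in>R. {y. invariant_norm (y - x) < d / 2})" using d by force
    then obtain F where F: "F \<subseteq> R" "finite F" "R \<subseteq> (\<Union>x\<in>F. {y. invariant_norm (y - x) < d / 2})"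
      using compactE_image[OF Rc, of R] op by metis
    have "F \<noteq> {}" using F R(3) by auto
    define n where "n = real (card F)"
    have n: "0 < n" using \<open>F \<noteq> {}\<close> F(2) by (simp add: n_def card_gt_0_iff)
    define u where "u = (\<Sum>x\<in>F. (1 / n) *\<^sub>R x)"
    have uR: "u \<in> R" unfolding u_def
      by (rule convex_sum[OF F(2) Rconv]) (use F n in \<open>auto simp: n_def\<close>)
    \<comment> \<open>Among the \<open>n\<close> distances averaged below, one is less than
      \<open>d / 2\<close> and the others are at most \<open>d\<close>; this is the resulting bound
      on the average.\<close>
    define r where "r = d - d / (2 * n)"
    have r: "r < d" using d n by (simp add: r_def)
    have close: "invariant_norm (y - u) \<le> r" if y: "y \<in> R" for y
    proof -
      obtain x0 where x0: "x0 \<in> F" "invariant_norm (y - x0) < d / 2" using F(3) y by auto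
      have "y = (\<Sum>x\<in>F. (1 / n) *\<^sub>R y)" using n by (simp add: n_def sum_constant_scaleR)
      then have "y - u = (\<Sum>x\<in>F. (1 / n) *\<^sub>R (y - x))"
        by (simp add: u_def sum_subtractf scaleR_diff_right)
      then have "invariant_norm (y - u) \<le> (\<Sum>x\<in>F. invariant_norm ((1 / n) *\<^sub>R (y - x)))"
        using invariant_norm_sum_le[OF F(2)] by simp
      also have "\<dots> \<le> (\<Sum>x\<in>F. 1 / n * invariant_norm (y - x))"
        by (intro sum_mono invariant_norm_scale_le) (use n in simp)
      also have "\<dots> = 1 / n * (\<Sum>x\<in>F. invariant_norm (y - x))" by (simp add: sum_distrib_left)
      also have "(\<Sum>x\<in>F. invariant_norm (y - x)) \<le> n * d - d / 2"
      proof -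
        have "(\<Sum>x\<in>F. invariant_norm (y - x)) = invariant_norm (y - x0) + (\<Sum>x\<in>F - {x0}. invariant_norm (y - x))"
          by (rule sum.remove[OF F(2) x0(1)])
        also have "(\<Sum>x\<in>F - {x0}. invariant_norm (y - x)) \<le> (\<Sum>x\<in>F - {x0}. d)"
          by (rule sum_mono) (use max y F d_def in auto)
        also have "(\<Sum>x\<in>F - {x0}. d) = (n - 1) * d"
          using n x0(1) F(2) by (simp add: n_def of_nat_diff)
        finally show ?thesis using x0(2) by (simp add: algebra_simps)
      qed
      also have "1 / n * (n * d - d / 2) = r" using n by (simp add: r_def field_simps)
      finally show ?thesis using n by (simp add: divide_right_mono)
    qed
    \<comment> \<open>This set is invariant because \<open>y - s z = s (t y - z)\<close> with
      \<open>t\<close> inverse to \<open>s\<close>: the operator is isometric for the invariant norm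
      and \<open>t y\<close> stays in \<open>R\<close>.\<close>
    define R' where "R' = {z \<in> R. \<forall>y\<in>R. invariant_norm (y - z) \<le> r}"
    have "closedin euclidean R'"
    proof -
      have "R' = R \<inter> (\<Inter>y\<in>R. {z. invariant_norm (y - z) \<le> r})" by (auto simp: R'_def)
      moreover have "closed {z. invariant_norm (y - z) \<le> r}" for y
        by (intro closed_Collect_le continuous_on_compose2[OF continuous_invariant_norm[of UNIV]]
            continuous_intros) auto
      ultimately show ?thesis using R(2) by auto
    qed
    moreover have "P R'"
      unfolding P_def
    proof (intro conjI ballI)
      show "convex R'"
      proof (rule convexI)
        fix z z' and p q :: real
        assume z: "z \<in> R'" "z' \<in> R'" and pq: "0 \<le> p" "0 \<le> q" "p + q = 1"
        have "invariant_norm (y - (p *\<^sub>R z + q *\<^sub>R z')) \<le> r" if "y \<in> R" for y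
        proof -
          have "y = p *\<^sub>R y + q *\<^sub>R y" using pq by (metis scaleR_left_distrib scaleR_one)
          then have "y - (p *\<^sub>R z + q *\<^sub>R z') = p *\<^sub>R (y - z) + q *\<^sub>R (y - z')"
            by (simp add: algebra_simps)
          then have "invariant_norm (y - (p *\<^sub>R z + q *\<^sub>R z')) \<le>
              p * invariant_norm (y - z) + q * invariant_norm (y - z')"
            using invariant_norm_triangle[of "p *\<^sub>R (y - z)" "q *\<^sub>R (y - z')"]
              invariant_norm_scale_le[OF pq(1), of "y - z"] invariant_norm_scale_le[OF pq(2), of "y - z'"]
            by simp
          also have "\<dots> \<le> p * r + q * r"
            using z that pq by (intro add_mono mult_left_mono) (auto simp: R'_def)
          also have "\<dots> = r" using pq by (metis distrib_right mult_1)
          finally show ?thesis .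
        qed
        then show "p *\<^sub>R z + q *\<^sub>R z' \<in> R'"
          using z convexD[OF Rconv _ _ pq] by (auto simp: R'_def)
      qed
      fix s assume s: "s \<in> S"
      obtain t where t: "t \<in> S" "\<And>v. s (t v) = v" using right_inverse[OF s] by metis
      show "s ` R' \<subseteq> R'"
      proof (intro image_subsetI)
        fix z assume z: "z \<in> R'"
        have "invariant_norm (y - s z) \<le> r" if "y \<in> R" for y
        proof -
          have "y - s z = s (t y - z)"
            using linear_diff[OF bounded_linear.linear[OF bounded_linear_op[OF s]]] t(2) by simp
          then have "invariant_norm (y - s z) = invariant_norm (t y - z)"
            by (simp add: invariant_norm_op[OF s])
          then show ?thesis using z Rinv[OF t(1) that] by (auto simp: R'_def)
        qed
        then show "s z \<in> R'" using z Rinv[OF s] by (auto simp: R'_def)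
      qed
    qed
    moreover have "R' \<noteq> {}" using uR close by (auto simp: R'_def)
    ultimately have "R' = R" by (intro min) (auto simp: R'_def)
    then have "d \<le> r" using ab unfolding R'_def d_def by blast
    with r show False by simp
  qed
  have single: "x = y" if "x \<in> R" "y \<in> R" for x y
  proof -
    have "norm (x - y) \<le> 0"
      using norm_le_invariant_norm[of "x - y"] max[OF that] \<open>d \<le> 0\<close> unfolding d_def by linarith
    then show ?thesis by simp
  qed
  show ?thesis
    by (rule that[of a]) (use ab R(1) Rinv single in auto)
qed

text \<open>By minimality every orbit in \<open>K\<close> is weakly dense in \<open>K\<close>, hence
  meets the small piece \<open>U\<close>. So the preimages of \<open>U\<close> cover
  \<open>K\<close>, and finitely many suffice. Pulling back through an inverse enlarges diameters at
  most by the factor \<open>M\<close>, whence the choice \<epsilon>/(2M) for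
  \<open>U\<close>.\<close>

lemma minimal_invariant_compact:
  assumes K: "compactin W K" "closedin W K" "K \<noteq> {}" "\<And>s. s \<in> S \<Longrightarrow> s ` K \<subseteq> K"
    and min: "\<And>K'. K' \<subseteq> K \<Longrightarrow> closedin W K' \<Longrightarrow> K' \<noteq> {} \<Longrightarrow> (\<And>s. s \<in> S \<Longrightarrow> s ` K' \<subseteq> K') \<Longrightarrow> K' = K"
  shows "compact K"
  unfolding compact_eq_totally_bounded
proof (intro conjI allI impI)
  show "complete K" using closedin_imp_closed[OF K(2)] by (simp add: complete_eq_closed)
  fix \<epsilon> :: real assume \<epsilon>: "0 < \<epsilon>"
  obtain M where M: "1 \<le> M" "\<And>s v. s \<in> S \<Longrightarrow> norm (s v) \<le> M * norm v"
    using uniform_bound by metis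
  have "0 < \<epsilon> / (2 * M)" using \<epsilon> M(1) by simp
  then obtain U where U: "openin W U" "U \<inter> K \<noteq> {}"
    and small: "\<And>x y. x \<in> U \<inter> K \<Longrightarrow> y \<in> U \<inter> K \<Longrightarrow> norm (x - y) \<le> \<epsilon> / (2 * M)"
    using weakly_compact_small_piece[OF K(1-3)] by metis
  have hit: "\<exists>s\<in>S. s x \<in> U" if x: "x \<in> K" for x
  proof -
    let ?O = "(\<lambda>s. s x) ` S"
    have "W closure_of ?O = K"
    proof (rule min)
      show "W closure_of ?O \<subseteq> K"
        by (rule closure_of_minimal) (use K x in auto)
      show "W closure_of ?O \<noteq> {}"
        using closure_of_subset[of ?O W] id_mem topspace_W by auto
      fix s assume s: "s \<in> S"
      have "s ` (W closure_of ?O) \<subseteq> W closure_of (s ` ?O)"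
        by (rule continuous_map_image_closure_subset[OF continuous_op[OF s]])
      also have "\<dots> \<subseteq> W closure_of ?O"
      proof (rule closure_of_mono)
        show "s ` ?O \<subseteq> ?O"
          by (auto simp: image_iff intro!: bexI[OF _ comp_mem[OF s]])
      qed
      finally show "s ` (W closure_of ?O) \<subseteq> W closure_of ?O" .
    qed simp
    then obtain y where "y \<in> U" "y \<in> W closure_of ?O" using U by blast
    then show ?thesis using U(1) unfolding in_closure_of by blast
  qed
  define V where "V s = {x. s x \<in> U}" for s :: "'v \<Rightarrow> 'v"
  have "openin W (V s)" if "s \<in> S" for s
    using openin_continuous_map_preimage[OF continuous_op[OF that] U(1)] by (simp add: V_def topspace_W)
  moreover have "K \<subseteq> \<Union>(V ` S)" using hit by (auto simp: V_def)
  ultimately obtain \<F> where "finite \<F>" "\<F> \<subseteq> V ` S" "K \<subseteq> \<Union>\<F>"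
    using K(1) unfolding compactin_def by (metis (no_types, lifting) imageE)
  then obtain F where F: "finite F" "F \<subseteq> S" "K \<subseteq> \<Union>(V ` F)"
    by (metis finite_subset_image)
  have "\<exists>z. \<forall>x\<in>V s \<inter> K. dist z x < \<epsilon>" if "s \<in> S" for s
  proof (cases "V s \<inter> K = {}")
    case False
    then obtain z where z: "z \<in> V s" "z \<in> K" by blast
    have "dist z x < \<epsilon>" if x: "x \<in> V s \<inter> K" for x
    proof -
      obtain t where t: "t \<in> S" "\<And>v. t (s v) = v" using right_inverse[OF \<open>s \<in> S\<close>] by metis
      have "norm (z - x) = norm (t (s z - s x))"
        using t linear_diff[OF bounded_linear.linear[OF bounded_linear_op[OF t(1)]]] by simp
      also have "\<dots> \<le> M * norm (s z - s x)" by (rule M(2)[OF t(1)])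
      also have "\<dots> \<le> M * (\<epsilon> / (2 * M))"
        by (rule mult_left_mono[OF small]) (use z x K(4)[OF \<open>s \<in> S\<close>] M(1) in \<open>auto simp: V_def\<close>)
      also have "\<dots> < \<epsilon>" using M(1) \<epsilon> by simp
      finally show ?thesis by (simp add: dist_norm)
    qed
    then show ?thesis by blast
  qed auto
  then obtain z where z: "\<And>s x. s \<in> S \<Longrightarrow> x \<in> V s \<inter> K \<Longrightarrow> dist (z s) x < \<epsilon>" by metis
  have "K \<subseteq> (\<Union>x\<in>z ` F. ball x \<epsilon>)" using F z by fastforce
  then show "\<exists>k. finite k \<and> K \<subseteq> (\<Union>x\<in>k. ball x \<epsilon>)" using F(1) by blast
qed

text \<open>The minimal set lives in the weak orbit closure, while averages approximate points of
  the norm closed hull. Mazur's theorem reconciles the two: that hull is weakly closed, so it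
  contains the weak orbit closure.\<close>

theorem fixed_point_in_closed_convex_hull:
  obtains x where "x \<in> closure (convex hull ((\<lambda>s. s v) ` S))" "\<And>s. s \<in> S \<Longrightarrow> s x = x"
proof -
  let ?O = "(\<lambda>s. s v) ` S"
  let ?K = "W closure_of ?O"
  define P where "P R \<longleftrightarrow> (\<forall>s\<in>S. s ` R \<subseteq> R)" for R
  have ne: "?K \<noteq> {}" using closure_of_subset[of ?O W] id_mem topspace_W by auto
  have PK: "P ?K"
    unfolding P_def
  proof
    fix s assume s: "s \<in> S"
    have "s ` ?K \<subseteq> W closure_of (s ` ?O)"
      by (rule continuous_map_image_closure_subset[OF continuous_op[OF s]])
    also have "\<dots> \<subseteq> ?K"
      by (rule closure_of_mono) (auto simp: image_iff intro!: bexI[OF _ comp_mem[OF s]])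
    finally show "s ` ?K \<subseteq> ?K" .
  qed
  have PInter: "P (\<Inter>\<C>)" if "\<C> \<noteq> {}" "\<And>C. C \<in> \<C> \<Longrightarrow> P C" for \<C>
    using that unfolding P_def by fastforce
  obtain K where K: "K \<subseteq> ?K" "closedin W K" "K \<noteq> {}" "P K"
    and min: "\<And>K'. K' \<subseteq> K \<Longrightarrow> closedin W K' \<Longrightarrow> K' \<noteq> {} \<Longrightarrow> P K' \<Longrightarrow> K' = K"
    using exists_minimal_closedin[of W ?K P, OF compactin_orbit closedin_closure_of ne PK PInter] by (metis (no_types))
  have KW: "compactin W K" by (rule closed_compactin[OF compactin_orbit K(1,2)])
  have "compact K"
    by (rule minimal_invariant_compact[OF KW K(2,3)]) (use K(4) min in \<open>auto simp: P_def\<close>)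
  define Q where "Q = closure (convex hull K)"
  have "compact Q" unfolding Q_def by (rule compact_closure_convex_hull) fact
  moreover have "convex Q" "Q \<noteq> {}" using K(3) by (auto simp: Q_def)
  moreover have "s ` Q \<subseteq> Q" if s: "s \<in> S" for s
  proof -
    have "s ` Q \<subseteq> closure (s ` (convex hull K))"
      unfolding Q_def by (rule closure_bounded_linear_image_subset[OF bounded_linear_op[OF s]])
    also have "s ` (convex hull K) = convex hull (s ` K)"
      by (rule convex_hull_linear_image[OF bounded_linear.linear[OF bounded_linear_op[OF s]]])
    also have "closure \<dots> \<subseteq> Q"
      unfolding Q_def by (intro closure_mono hull_mono) (use K(4) s P_def in blast)
    finally show ?thesis .
  qed
  ultimately obtain x where x: "x \<in> Q" "\<And>s. s \<in> S \<Longrightarrow> s x = x"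
    using compact_convex_fixed_point[of Q] by metis
  have "?K \<subseteq> closure (convex hull ?O)"
  proof (rule closure_of_minimal)
    show "?O \<subseteq> closure (convex hull ?O)" by (rule order_trans[OF hull_subset closure_subset])
  qed (auto intro: closedin_convex)
  then have "Q \<subseteq> closure (convex hull ?O)"
    unfolding Q_def using K(1) by (intro closure_minimal hull_minimal) auto
  with x that show ?thesis by blast
qed

section \<open>Averages of the operators and the mean ergodic theorem\<close>

lemma average_bounded_linear: "m \<in> averages S \<Longrightarrow> bounded_linear m"
  by (induction rule: averages.induct)
    (auto intro: bounded_linear_op bounded_linear_add bounded_linear_compose[OF bounded_linear_scaleR_right])

lemma average_bound:
  assumes M: "\<And>s v. s \<in> S \<Longrightarrow> norm (s v) \<le> M * norm v" and "m \<in> averages S"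
  shows "norm (m v) \<le> M * norm v"
  using assms(2)
proof (induction rule: averages.induct)
  case (mix m m' u w)
  have "norm (u *\<^sub>R m v + w *\<^sub>R m' v) \<le> u * norm (m v) + w * norm (m' v)"
    using norm_triangle_ineq[of "u *\<^sub>R m v" "w *\<^sub>R m' v"] mix by simp
  also have "\<dots> \<le> u * (M * norm v) + w * (M * norm v)"
    using mix by (intro add_mono mult_left_mono) auto
  also have "\<dots> = M * norm v" using mix by (metis distrib_right mult_1)
  finally show ?case .
qed (rule M)

text \<open>Expanding the composite gives a convex combination of products, and products stay in
  \<open>S\<close>. This permits averaging again after an earlier average.\<close>

lemma average_comp:
  assumes "m \<in> averages S" "m' \<in> averages S"
  shows "m \<circ> m' \<in> averages S"
  using assms(1)
proof (induction rule: averages.induct)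
  case (base s)
  show ?case using assms(2)
  proof (induction rule: averages.induct)
    case (base t)
    then show ?case by (intro averages.base comp_mem \<open>s \<in> S\<close>)
  next
    case (mix m m' u w)
    have "s \<circ> (\<lambda>v. u *\<^sub>R m v + w *\<^sub>R m' v) = (\<lambda>v. u *\<^sub>R (s \<circ> m) v + w *\<^sub>R (s \<circ> m') v)"
      using bounded_linear.linear[OF bounded_linear_op[OF \<open>s \<in> S\<close>]]
      by (auto simp: linear_add linear_scale)
    then show ?case using averages.mix[OF mix.IH mix.hyps(3-5)] by simp
  qed
next
  case (mix m m'' u w)
  then show ?case using averages.mix[OF mix.IH mix.hyps(3-5)] by (simp add: comp_def)
qed

text \<open>A further average \<open>m'\<close> can enlarge what was already small by at most
  \<open>M\<close>, so the earlier vectors are first made smaller than \<delta>/M. The same bound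
  controls the error of the final net, chosen with radius \<epsilon>/(2M).\<close>

theorem averages_small_on_compact:
  assumes fixed: "\<And>x. (\<And>s. s \<in> S \<Longrightarrow> s x = x) \<Longrightarrow> x = 0"
    and L: "compact L" and \<epsilon>: "0 < \<epsilon>"
  obtains m where "m \<in> averages S" "\<And>v. v \<in> L \<Longrightarrow> norm (m v) < \<epsilon>"
proof -
  obtain M where M: "1 \<le> M" "\<And>s v. s \<in> S \<Longrightarrow> norm (s v) \<le> M * norm v"
    using uniform_bound by metis
  have single: "\<exists>m\<in>averages S. norm (m v) < \<delta>" if \<delta>: "0 < \<delta>" for v \<delta>
  proof -
    have conv: "convex ((\<lambda>m. m v) ` averages S)"
    proof (rule convexI)
      fix x y and u w :: real
      assume xy: "x \<in> (\<lambda>m. m v) ` averages S" "y \<in> (\<lambda>m. m v) ` averages S"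
        and uw: "0 \<le> u" "0 \<le> w" "u + w = 1"
      then obtain m m' where m: "m \<in> averages S" "m' \<in> averages S" "x = m v" "y = m' v" by blast
      show "u *\<^sub>R x + w *\<^sub>R y \<in> (\<lambda>m. m v) ` averages S"
        by (rule image_eqI[OF _ averages.mix[OF m(1,2) uw]]) (simp add: m)
    qed
    obtain x where x: "x \<in> closure (convex hull ((\<lambda>s. s v) ` S))" "\<And>s. s \<in> S \<Longrightarrow> s x = x"
      using fixed_point_in_closed_convex_hull by metis
    have "convex hull ((\<lambda>s. s v) ` S) \<subseteq> (\<lambda>m. m v) ` averages S"
      by (intro hull_minimal conv) (auto intro: averages.base)
    then have "0 \<in> closure ((\<lambda>m. m v) ` averages S)"
      using x fixed[of x] closure_mono by blast
    then show ?thesis using \<delta> unfolding closure_approachable by auto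
  qed
  have fin: "\<exists>m\<in>averages S. \<forall>v\<in>F. norm (m v) < \<delta>" if "finite F" "0 < \<delta>" for F \<delta>
    using that
  proof (induction F arbitrary: \<delta> rule: finite_induct)
    case empty
    then show ?case using averages.base[OF id_mem] by auto
  next
    case (insert v F)
    have "0 < \<delta> / M" using insert.prems M(1) by simp
    then obtain m where m: "m \<in> averages S" "\<And>w. w \<in> F \<Longrightarrow> norm (m w) < \<delta> / M"
      using insert.IH by blast
    obtain m' where m': "m' \<in> averages S" "norm (m' (m v)) < \<delta>"
      using single[OF insert.prems] by blast
    have "norm (m' (m w)) < \<delta>" if "w \<in> F" for w
    proof -
      have "norm (m' (m w)) \<le> M * norm (m w)" by (rule average_bound[OF _ m'(1)]) (rule M(2))
      also have "\<dots> < M * (\<delta> / M)" by (rule mult_strict_left_mono) (use m(2)[OF that] M(1) in auto)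
      finally show ?thesis using M(1) by simp
    qed
    then show ?case using average_comp[OF m'(1) m(1)] m'(2) by (intro bexI[of _ "m' \<circ> m"]) auto
  qed
  have "0 < \<epsilon> / (2 * M)" using \<epsilon> M(1) by simp
  then obtain F where F: "finite F" "L \<subseteq> (\<Union>x\<in>F. ball x (\<epsilon> / (2 * M)))"
    using L unfolding compact_eq_totally_bounded by blast
  obtain m where m: "m \<in> averages S" "\<And>v. v \<in> F \<Longrightarrow> norm (m v) < \<epsilon> / 2"
    using fin[OF F(1), of "\<epsilon> / 2"] \<epsilon> by auto
  show ?thesis
  proof (rule that[OF m(1)])
    fix v assume "v \<in> L"
    then obtain w where w: "w \<in> F" "dist w v < \<epsilon> / (2 * M)" using F by auto
    have "m v = m w + m (v - w)"
      using linear_diff[OF bounded_linear.linear[OF average_bounded_linear[OF m(1)]]] by simp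
    moreover have "norm (m (v - w)) \<le> M * norm (v - w)" by (rule average_bound[OF _ m(1)]) (rule M(2))
    moreover have "M * norm (v - w) < M * (\<epsilon> / (2 * M))"
      by (rule mult_strict_left_mono) (use w(2) M(1) in \<open>auto simp: dist_norm norm_minus_commute\<close>)
    moreover have "M * (\<epsilon> / (2 * M)) = \<epsilon> / 2" using M(1) by simp
    ultimately show "norm (m v) < \<epsilon>"
      using m(2)[OF w(1)] norm_triangle_ineq[of "m w" "m (v - w)"] by simp
  qed
qed

end

section \<open>The weak topology of a real or complex Banach space\<close>

lemma bounded_functionalI:
  fixes scl :: "'k::real_or_complex \<Rightarrow> 'v::banach \<Rightarrow> 'v"
  assumes "banach_space scl" "bounded_linear \<phi>" "\<And>a v. \<phi> (scl a v) = a * \<phi> v"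
  shows "bounded_functional scl \<phi>"
proof -
  interpret banach_space scl by fact
  have "Vector_Spaces.linear scl (*) \<phi>"
    unfolding module_hom_iff_linear[symmetric]
    by unfold_locales (use assms linear_add[OF bounded_linear.linear[OF assms(2)]] in \<open>simp_all add: algebra_simps\<close>)
  then show ?thesis using assms(2) by (simp add: bounded_functional_def)
qed

lemma bounded_functionalD:
  assumes "bounded_functional scl \<phi>"
  shows "bounded_linear \<phi>" "\<phi> (scl a v) = a * \<phi> v"
proof -
  interpret \<phi>: Vector_Spaces.linear scl "(*)" \<phi> using assms by (simp add: bounded_functional_def)
  show "\<phi> (scl a v) = a * \<phi> v" by (rule \<phi>.scale)
qed (use assms in \<open>simp add: bounded_functional_def\<close>)

lemma bounded_operatorD:
  assumes "bounded_operator scl A"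
  shows "bounded_linear A" "A (scl a v) = scl a (A v)"
proof -
  interpret A: Vector_Spaces.linear scl scl A using assms by (simp add: bounded_operator_def)
  show "A (scl a v) = scl a (A v)" by (rule A.scale)
qed (use assms in \<open>simp add: bounded_operator_def\<close>)

text \<open>Here \<open>g\<close> plays the role of \<open>Re\<close>, and \<open>\<phi> v = f v - i f(i v)\<close> if the scalars are complex.\<close>

lemma real_functional_factors:
  fixes scl :: "'k::real_or_complex \<Rightarrow> 'v::banach \<Rightarrow> 'v" and f :: "'v \<Rightarrow> real"
  assumes "banach_space scl" and f: "bounded_linear f"
  obtains \<phi> and g :: "'k \<Rightarrow> real"
  where "bounded_functional scl \<phi>" "bounded_linear g" "\<And>v. f v = g (\<phi> v)"
proof -
  interpret banach_space scl by fact
  interpret f: bounded_linear f by fact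
  show ?thesis
    using real_or_complex[where ?'a = 'k]
  proof (elim disjE exE conjE)
    assume all: "\<forall>x::'k. \<exists>a. x = a *\<^sub>R 1"
    then obtain g :: "'k \<Rightarrow> real" where g: "\<And>x. x = of_real (g x)" unfolding of_real_def by metis
    have uniq: "g (of_real a) = a" for a using g[of "of_real a"] by (metis of_real_eq_iff)
    have "bounded_linear g"
    proof (rule bounded_linear_intro[where K = 1])
      show "g (x + y) = g x + g y" for x y using g[of x] g[of y] uniq by (metis of_real_add)
      show "g (r *\<^sub>R x) = r *\<^sub>R g x" for r x
        using g[of x] uniq by (metis of_real_mult real_scaleR_def scaleR_conv_of_real)
      show "norm (g x) \<le> norm x * 1" for x using g[of x] by (metis norm_of_real mult_1_right order_refl real_norm_def)
    qed
    moreover have "bounded_functional scl (\<lambda>v. of_real (f v) :: 'k)"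
    proof (rule bounded_functionalI)
      show "bounded_linear (\<lambda>v. of_real (f v) :: 'k)"
        by (rule bounded_linear_compose[OF bounded_linear_of_real f])
      show "of_real (f (scl a v)) = a * of_real (f v)" for a v
        using g[of a] scale_of_real[of "g a" v] by (metis f.scaleR of_real_mult real_scaleR_def)
    qed fact
    ultimately show thesis using that uniq by metis
  next
    fix i :: 'k assume i: "i * i = - 1" and all: "\<forall>x. \<exists>a b. x = a *\<^sub>R 1 + b *\<^sub>R i"
    have "norm i * norm i = 1" using i by (metis norm_minus_cancel norm_mult norm_one)
    then have ni: "norm i = 1" by (metis abs_norm_cancel abs_square_eq_1 power2_eq_square)
    \<comment> \<open>Multiplying by the conjugate produces the sum of squares. The estimate yields
      both the uniqueness of the coordinates \<open>g\<close> and \<open>h\<close> and the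
      boundedness of \<open>g\<close>.\<close>
    have est: "\<bar>a\<bar> + \<bar>b\<bar> \<le> 2 * norm (of_real a + of_real b * i)" for a b
    proof (cases "\<bar>a\<bar> + \<bar>b\<bar> = 0")
      case False
      let ?s = "\<bar>a\<bar> + \<bar>b\<bar>" and ?x = "of_real a + of_real b * i" and ?y = "of_real a - of_real b * i"
      have "?x * ?y = of_real a * of_real a - (of_real b * of_real b) * (i * i)" by (simp add: algebra_simps)
      also have "\<dots> = of_real (a * a + b * b)" by (simp add: i)
      finally have "norm ?x * norm ?y = a * a + b * b"
        by (metis abs_of_nonneg add_nonneg_nonneg norm_mult norm_of_real zero_le_square)
      moreover have "norm ?y \<le> ?s"
        using norm_triangle_ineq4[of "of_real a" "of_real b * i"] by (simp add: norm_mult ni)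
      then have "norm ?x * norm ?y \<le> norm ?x * ?s" by (rule mult_left_mono) simp
      moreover have "?s * ?s \<le> 2 * (a * a + b * b)"
        using zero_le_square[of "\<bar>a\<bar> - \<bar>b\<bar>"] by (simp add: algebra_simps)
      ultimately have "?s * ?s \<le> (2 * norm ?x) * ?s" by simp
      then show ?thesis using False by (simp add: mult_le_cancel_right)
    next
      case True
      then have "a = 0" "b = 0" by linarith+
      then show ?thesis by simp
    qed
    obtain g h :: "'k \<Rightarrow> real" where gh: "\<And>x. x = of_real (g x) + of_real (h x) * i"
      using all unfolding of_real_def mult_scaleR_left by (metis mult_1)
    have uniq: "g x = a \<and> h x = b" if "x = of_real a + of_real b * i" for x a b
    proof -
      have "of_real (g x - a) + of_real (h x - b) * i = x - x"
        using gh[of x] that by (simp add: algebra_simps)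
      then have "\<bar>g x - a\<bar> + \<bar>h x - b\<bar> \<le> 0" using est[of "g x - a" "h x - b"] by simp
      then show ?thesis by linarith
    qed
    have "bounded_linear g"
    proof (rule bounded_linear_intro[where K = 2])
      show "g (x + y) = g x + g y" for x y
        using gh[of x] gh[of y] uniq[of "x + y" "g x + g y" "h x + h y"] by (simp add: algebra_simps)
      show "g (r *\<^sub>R x) = r *\<^sub>R g x" for r x
      proof -
        have "r *\<^sub>R x = of_real r * (of_real (g x) + of_real (h x) * i)"
          using gh[of x] by (simp add: scaleR_conv_of_real)
        also have "\<dots> = of_real (r * g x) + of_real (r * h x) * i" by (simp add: algebra_simps)
        finally have "r *\<^sub>R x = of_real (r * g x) + of_real (r * h x) * i" .
        from uniq[OF this] show ?thesis by simp
      qed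
      show "norm (g x) \<le> norm x * 2" for x using est[of "g x" "h x"] gh[of x] by simp
    qed
    moreover define \<phi> where "\<phi> = (\<lambda>v. of_real (f v) - of_real (f (scl i v)) * i)"
    have sclR: "scl a (r *\<^sub>R v) = r *\<^sub>R scl a v" for a r v
      using scale_left_commute[of a "of_real r" v] unfolding scale_of_real .
    have "bounded_linear (scl i)"
      by (rule bounded_linear_intro[where K = 1]) (simp_all add: scale_right_distrib sclR norm_scale ni)
    then have bl: "bounded_linear \<phi>"
      unfolding \<phi>_def
      by (intro bounded_linear_sub bounded_linear_compose[OF bounded_linear_of_real]
          bounded_linear_compose[OF bounded_linear_mult_left] f bounded_linear_compose[OF f])
    then interpret \<phi>: bounded_linear \<phi> .
    have "bounded_functional scl \<phi>"
    proof (rule bounded_functionalI)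
      fix a v
      have "scl i (scl i v) = scl (- 1) v" by (simp add: i)
      also have "\<dots> = - v" by simp
      finally have "\<phi> (scl i v) = i * \<phi> v"
        by (simp add: \<phi>_def f.neg right_diff_distrib mult.left_commute[of i] i)
      moreover have "scl a v = g a *\<^sub>R v + h a *\<^sub>R scl i v"
      proof -
        have "scl a v = scl (of_real (g a) + of_real (h a) * i) v" using gh[of a] by simp
        also have "\<dots> = scl (of_real (g a)) v + scl (of_real (h a)) (scl i v)"
          by (simp add: scale_left_distrib)
        finally show ?thesis unfolding scale_of_real .
      qed
      ultimately have "\<phi> (scl a v) = (of_real (g a) + of_real (h a) * i) * \<phi> v"
        by (simp add: \<phi>.add \<phi>.scaleR scaleR_conv_of_real algebra_simps)
      then show "\<phi> (scl a v) = a * \<phi> v" using gh[of a] by simp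
    qed fact+
    moreover have "f v = g (\<phi> v)" for v
      using uniq[of "\<phi> v" "f v" "- f (scl i v)"] by (simp add: \<phi>_def)
    ultimately show thesis using that by blast
  qed
qed

lemma weak_like_topology_weak:
  fixes scl :: "'k::real_or_complex \<Rightarrow> 'v::banach \<Rightarrow> 'v"
  assumes "banach_space scl"
  shows "weak_like_topology (weak_topology scl)"
proof
  have "bounded_functional scl (\<lambda>_. 0)" by (rule bounded_functionalI[OF assms]) (simp_all add: bounded_linear_zero)
  then have "(\<lambda>_. 0) -` (UNIV :: 'k set) \<in> {\<phi> -` U | \<phi> U. bounded_functional scl \<phi> \<and> open U}"
    using open_UNIV by blast
  then show top: "topspace (weak_topology scl) = UNIV"
    unfolding weak_topology_def topology_generated_by_topspace by blast
  show "continuous_map (weak_topology scl) euclideanreal f" if f: "bounded_linear f" for f :: "'v \<Rightarrow> real"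
  proof -
    obtain \<phi> and g :: "'k \<Rightarrow> real"
      where \<phi>: "bounded_functional scl \<phi>" and g: "bounded_linear g" and fg: "\<And>v. f v = g (\<phi> v)"
      by (rule real_functional_factors[OF assms f]) blast
    have "openin (weak_topology scl) {v. f v \<in> U}" if "open U" for U
    proof -
      have "open (g -` U)"
        using that g by (intro open_vimage linear_continuous_on)
      moreover have "{v. f v \<in> U} = \<phi> -` (g -` U)" by (auto simp: fg)
      ultimately show ?thesis
        unfolding weak_topology_def using \<phi> by (intro topology_generated_by_Basis) blast
    qed
    then show ?thesis by (auto simp: continuous_map_def top)
  qed
  show "open U" if "openin (weak_topology scl) U" for U
  proof -
    have "generate_topology_on {\<phi> -` U | \<phi> U. bounded_functional scl \<phi> \<and> open U} U"
      using that unfolding weak_topology_def by (rule openin_topology_generated_by)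
    then show ?thesis
    proof (induction rule: generate_topology_on.induct)
      case (Basis s)
      then show ?case
        by (auto intro!: open_vimage linear_continuous_on dest: bounded_functionalD(1))
    qed auto
  qed
qed

lemma continuous_map_bounded_operator:
  assumes "banach_space scl" and A: "bounded_operator scl A"
  shows "continuous_map (weak_topology scl) (weak_topology scl) A"
proof -
  interpret weak_like_topology "weak_topology scl" by (rule weak_like_topology_weak) fact
  have "continuous_map (weak_topology scl) (topology_generated_by
      {\<phi> -` U | \<phi> U. bounded_functional scl \<phi> \<and> open U}) A"
  proof (rule continuous_on_generated_topo)
    fix V assume "V \<in> {\<phi> -` U | \<phi> U. bounded_functional scl \<phi> \<and> open U}"
    then obtain \<phi> U where \<phi>: "V = \<phi> -` U" "bounded_functional scl \<phi>" "open U" by blast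
    have "bounded_functional scl (\<phi> \<circ> A)"
    proof (rule bounded_functionalI)
      show "bounded_linear (\<phi> \<circ> A)"
        unfolding comp_def
        by (rule bounded_linear_compose[OF bounded_functionalD(1)[OF \<phi>(2)] bounded_operatorD(1)[OF A]])
    qed (simp_all add: assms bounded_operatorD(2)[OF A] bounded_functionalD(2)[OF \<phi>(2)])
    moreover have "A -` V \<inter> topspace (weak_topology scl) = (\<phi> \<circ> A) -` U"
      by (auto simp: \<phi>(1) topspace_W)
    ultimately show "openin (weak_topology scl) (A -` V \<inter> topspace (weak_topology scl))"
      using \<phi>(3) unfolding weak_topology_def by (intro topology_generated_by_Basis) auto
  next
    show "A ` topspace (weak_topology scl) \<subseteq> \<Union>{\<phi> -` U | \<phi> U. bounded_functional scl \<phi> \<and> open U}"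
      using topspace_W unfolding weak_topology_def by simp
  qed
  then show ?thesis by (simp add: weak_topology_def)
qed

section \<open>Representations and the operators coming from a subgroup\<close>

locale banach_module_group = group G for G (structure) +
  fixes scl :: "'k::real_or_complex \<Rightarrow> 'v::banach \<Rightarrow> 'v" and \<rho>
  assumes banach_module: "banach_module scl G \<rho>"
begin

lemma banach_space: "banach_space scl"
  using banach_module by (simp add: banach_module_def)

lemma hom_GL: "\<rho> \<in> hom G (GL scl)"
  using banach_module by (simp add: banach_module_def)

lemma bounded_operator: "g \<in> carrier G \<Longrightarrow> bounded_operator scl (\<rho> g)"
  using hom_GL by (auto simp: hom_def GL_def)

lemma bounded_linear: "g \<in> carrier G \<Longrightarrow> bounded_linear (\<rho> g)"
  by (rule bounded_operatorD(1)[OF bounded_operator])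

lemma linear: "g \<in> carrier G \<Longrightarrow> linear (\<rho> g)"
  by (rule bounded_linear.linear[OF bounded_linear])

lemma rep_mult: "g \<in> carrier G \<Longrightarrow> h \<in> carrier G \<Longrightarrow> \<rho> (g \<otimes> h) v = \<rho> g (\<rho> h v)"
  using hom_GL by (auto simp: hom_def GL_def)

text \<open>Membership in \<open>hom\<close> only gives multiplicativity. An idempotent with a left
  inverse is the identity.\<close>

lemma rep_one: "\<rho> \<one> = id"
proof -
  have "\<rho> \<one> \<in> carrier (GL scl)" using hom_GL by (auto simp: hom_def)
  then obtain B where "B \<circ> \<rho> \<one> = id" by (auto simp: GL_def)
  then have B: "B (\<rho> \<one> v) = v" for v by (metis comp_apply id_apply)
  have "\<rho> \<one> v = v" for v using rep_mult[of \<one> \<one> v] B by (metis one_closed l_one)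
  then show ?thesis by auto
qed

lemma weakly_compact_group_subgroup:
  assumes C: "subgroup C G" and wap: "weakly_almost_periodic scl G \<rho>"
  shows "weakly_compact_group (weak_topology scl) (\<rho> ` C)"
proof -
  interpret weak_like_topology "weak_topology scl" by (rule weak_like_topology_weak[OF banach_space])
  have CG: "C \<subseteq> carrier G" using C by (rule subgroup.subset)
  show ?thesis
  proof (intro weakly_compact_group.intro weakly_compact_group_axioms.intro weak_like_topology_weak[OF banach_space])
    show "bounded_linear s" if "s \<in> \<rho> ` C" for s using that CG bounded_linear by blast
    show "continuous_map (weak_topology scl) (weak_topology scl) s" if "s \<in> \<rho> ` C" for s
      using that CG bounded_operator continuous_map_bounded_operator[OF banach_space] by blast
    show "id \<in> \<rho> ` C" using subgroup.one_closed[OF C] rep_one by (metis image_eqI)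
    show "s \<circ> t \<in> \<rho> ` C" if st: "s \<in> \<rho> ` C" "t \<in> \<rho> ` C" for s t
    proof -
      obtain x y where xy: "x \<in> C" "y \<in> C" "s = \<rho> x" "t = \<rho> y" using st by blast
      then have "s \<circ> t = \<rho> (x \<otimes> y)" using CG by (auto simp: rep_mult subset_iff)
      then show ?thesis using subgroup.m_closed[OF C xy(1,2)] by blast
    qed
    show "\<exists>t\<in>\<rho> ` C. t \<circ> s = id" if s: "s \<in> \<rho> ` C" for s
    proof -
      obtain x where x: "x \<in> C" "s = \<rho> x" using s by blast
      then have xG: "x \<in> carrier G" using CG by blast
      have "\<rho> (inv x) (\<rho> x v) = v" for v
        using rep_mult[of "inv x" x v] xG rep_one by simp
      then have "\<rho> (inv x) \<circ> s = id" using x by auto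
      then show ?thesis using subgroup.m_inv_closed[OF C x(1)] by blast
    qed
    show "compactin (weak_topology scl) (weak_topology scl closure_of ((\<lambda>s. s v) ` \<rho> ` C))" for v
    proof (rule closed_compactin)
      show "compactin (weak_topology scl) (weak_topology scl closure_of Group_Action.orbit G \<rho> v)"
        using wap by (simp add: weakly_almost_periodic_def)
      show "weak_topology scl closure_of ((\<lambda>s. s v) ` \<rho> ` C)
          \<subseteq> weak_topology scl closure_of Group_Action.orbit G \<rho> v"
        by (rule closure_of_mono) (use CG in \<open>auto simp: orbit_def\<close>)
    qed simp
  qed
qed

lemma averages_small_on_compact:
  assumes C: "subgroup C G" and wap: "weakly_almost_periodic scl G \<rho>"
    and fixed: "fixed_vectors \<rho> C = {0}" and L: "compact L" and \<epsilon>: "0 < \<epsilon>"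
  obtains m where "m \<in> averages (\<rho> ` C)" "\<And>v. v \<in> L \<Longrightarrow> norm (m v) < \<epsilon>"
proof -
  interpret weakly_compact_group "weak_topology scl" "\<rho> ` C"
    by (rule weakly_compact_group_subgroup[OF C wap])
  have "x = 0" if "\<And>s. s \<in> \<rho> ` C \<Longrightarrow> s x = x" for x
    using fixed that by (auto simp: fixed_vectors_def)
  then show ?thesis using averages_small_on_compact[OF _ L \<epsilon>] that by metis
qed

end

section \<open>The compact-open topology\<close>

lemma compact_image_continuous_maps:
  assumes "f \<in> continuous_maps X" "compactin X K"
  shows "compact (f ` K)"
  using assms image_compactin[of X K euclidean f] by (simp add: continuous_maps_def)

text \<open>With the next lemma, this identifies the topology with uniform convergence on compact
  sets. In a subbasic set, the compact image of \<open>f\<close> has a uniform margin inside the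
  open target; intersections take unions of compact sets and minima of margins.\<close>

lemma compact_open_uniform_neighbourhood:
  fixes f :: "'x \<Rightarrow> 'v::banach"
  assumes f: "f \<in> U" and U: "openin (compact_open_topology X) U"
  shows "\<exists>K \<epsilon>. compactin X K \<and> 0 < \<epsilon> \<and>
    (\<forall>g\<in>continuous_maps X. (\<forall>x\<in>K. norm (g x - f x) < \<epsilon>) \<longrightarrow> g \<in> U)"
proof -
  have "generate_topology_on {{f \<in> continuous_maps X. f ` K \<subseteq> U} | K U. compactin X K \<and> open U} U"
    using U unfolding compact_open_topology_def by (rule openin_topology_generated_by)
  then show ?thesis using f
  proof (induction rule: generate_topology_on.induct)
    case (Int a b)
    have f: "f \<in> a" "f \<in> b" using Int.prems by auto
    obtain K \<epsilon> where 1: "compactin X K" "0 < \<epsilon>"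
      "\<forall>g\<in>continuous_maps X. (\<forall>x\<in>K. norm (g x - f x) < \<epsilon>) \<longrightarrow> g \<in> a"
      using Int.IH(1)[OF f(1)] by blast
    obtain K' \<epsilon>' where 2: "compactin X K'" "0 < \<epsilon>'"
      "\<forall>g\<in>continuous_maps X. (\<forall>x\<in>K'. norm (g x - f x) < \<epsilon>') \<longrightarrow> g \<in> b"
      using Int.IH(2)[OF f(2)] by blast
    show ?case
    proof (intro exI conjI ballI impI)
      show "compactin X (K \<union> K')" using 1 2 by (simp add: compactin_Un)
      show "0 < min \<epsilon> \<epsilon>'" using 1 2 by simp
      fix g assume "g \<in> continuous_maps X" "\<forall>x\<in>K \<union> K'. norm (g x - f x) < min \<epsilon> \<epsilon>'"
      then show "g \<in> a \<inter> b" using 1(3) 2(3) by simp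
    qed
  next
    case (UN \<K>)
    then obtain a where a: "a \<in> \<K>" "f \<in> a" by blast
    then obtain K \<epsilon> where "compactin X K" "0 < \<epsilon>"
      "\<forall>g\<in>continuous_maps X. (\<forall>x\<in>K. norm (g x - f x) < \<epsilon>) \<longrightarrow> g \<in> a"
      using UN.IH[OF a] by blast
    then show ?case using a(1) by (intro exI[of _ K] exI[of _ \<epsilon>]) blast
  next
    case (Basis s)
    then obtain K V where KV: "s = {f \<in> continuous_maps X. f ` K \<subseteq> V}" "compactin X K" "open V" by blast
    have fK: "compact (f ` K)" "f ` K \<subseteq> V"
      using Basis.prems KV compact_image_continuous_maps by auto
    obtain \<epsilon> where \<epsilon>: "0 < \<epsilon>" "(\<Union>y\<in>f ` K. ball y \<epsilon>) \<subseteq> V"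
      using compact_subset_open_imp_ball_epsilon_subset[OF fK(1) KV(3) fK(2)] by metis
    have "g \<in> s" if "g \<in> continuous_maps X" "\<forall>x\<in>K. norm (g x - f x) < \<epsilon>" for g
    proof -
      have "g x \<in> ball (f x) \<epsilon>" if "x \<in> K" for x
        using \<open>\<forall>x\<in>K. norm (g x - f x) < \<epsilon>\<close> that by (auto simp: dist_norm norm_minus_commute)
      then show ?thesis using \<epsilon>(2) that(1) KV(1) by blast
    qed
    then show ?case using KV(2) \<epsilon>(1) by blast
  qed simp
qed

text \<open>Cut \<open>K\<close> into finitely many compact parts on which \<open>f\<close> stays
  within \<epsilon>/4 of one point, and require \<open>g\<close> to stay within \<epsilon>/2 of it
  there. Closed balls keep the parts compact.\<close>

lemma compact_open_uniform_ball:
  fixes f :: "'x \<Rightarrow> 'v::banach"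
  assumes f: "f \<in> continuous_maps X" and K: "compactin X K" and \<epsilon>: "0 < \<epsilon>"
  obtains U where "openin (compact_open_topology X) U" "f \<in> U"
    "\<And>g x. g \<in> U \<Longrightarrow> x \<in> K \<Longrightarrow> norm (g x - f x) < \<epsilon>"
proof -
  have cont: "continuous_map X euclidean f" using f by (simp add: continuous_maps_def)
  have "compact (f ` K)" using compact_image_continuous_maps[OF f K] .
  moreover have "0 < \<epsilon> / 4" using \<epsilon> by simp
  ultimately obtain F where F: "finite F" "f ` K \<subseteq> (\<Union>y\<in>F. ball y (\<epsilon> / 4))"
    unfolding compact_eq_totally_bounded by blast
  define L where "L y = K \<inter> {x \<in> topspace X. f x \<in> cball y (\<epsilon> / 4)}" for y
  have L: "compactin X (L y)" for y
    unfolding L_def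
    by (intro compact_Int_closedin K closedin_continuous_map_preimage[OF cont]) simp
  define B where "B y = {g \<in> continuous_maps X. g ` L y \<subseteq> ball y (\<epsilon> / 2)}" for y
  \<comment> \<open>The factor with the arbitrary centre \<open>f undefined\<close> keeps
    \<open>U\<close> among the continuous maps when \<open>F\<close> is empty.\<close>
  define U where "U = B (f undefined) \<inter> (\<Inter>y\<in>F. B y)"
  have B: "openin (compact_open_topology X) (B y)" for y
    unfolding compact_open_topology_def B_def
    by (rule topology_generated_by_Basis) (use L in blast)
  have fB: "f \<in> B y" for y
    using f \<epsilon> by (auto simp: B_def L_def)
  show ?thesis
  proof
    show "openin (compact_open_topology X) U"
    proof (cases "F = {}")
      case False
      then show ?thesis unfolding U_def using F(1) B by (intro openin_Int openin_INT2) auto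
    qed (simp add: U_def B)
    show "f \<in> U" using fB by (simp add: U_def)
    fix g x assume g: "g \<in> U" and x: "x \<in> K"
    obtain y where y: "y \<in> F" "dist y (f x) < \<epsilon> / 4" using F(2) x by auto
    have "x \<in> topspace X" using K x compactin_subset_topspace by blast
    then have "x \<in> L y" using x y by (simp add: L_def less_imp_le)
    moreover have "g \<in> B y" using g y(1) by (simp add: U_def)
    ultimately have "dist y (g x) < \<epsilon> / 2" by (auto simp: B_def)
    then have "dist (g x) (f x) < \<epsilon>" using y(2) dist_triangle3[of "g x" "f x" y] \<epsilon> by linarith
    then show "norm (g x - f x) < \<epsilon>" by (simp add: dist_norm)
  qed
qed

section \<open>Cochains and coboundaries\<close>

lemma continuous_map_bounded_linear:
  assumes "bounded_linear m" "continuous_map X euclidean f"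
  shows "continuous_map X euclidean (\<lambda>x. m (f x))"
  using continuous_map_compose[OF assms(2), of euclidean m] linear_continuous_on[OF assms(1), of UNIV]
  by (simp add: comp_def)

context banach_module_group
begin

lemma equivariant_maps_lincomb:
  assumes "f \<in> equivariant_maps G T \<rho> m" "f' \<in> equivariant_maps G T \<rho> m"
  shows "(\<lambda>x. u *\<^sub>R f x + w *\<^sub>R f' x) \<in> equivariant_maps G T \<rho> m"
  using assms unfolding equivariant_maps_def continuous_maps_def
  by (auto intro!: continuous_map_add continuous_map_bounded_linear[OF bounded_linear_scaleR_right]
      simp: linear_add[OF linear] linear_scale[OF linear])

lemma equivariant_maps_zero: "(\<lambda>_. 0) \<in> equivariant_maps G T \<rho> m"
  by (auto simp: equivariant_maps_def continuous_maps_def linear_0[OF linear])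

lemma coboundaries_lincomb:
  assumes "f \<in> coboundaries G T \<rho> n" "f' \<in> coboundaries G T \<rho> n"
  shows "(\<lambda>x. u *\<^sub>R f x + w *\<^sub>R f' x) \<in> coboundaries G T \<rho> n"
proof (cases "n = 0")
  case True
  then show ?thesis using assms by (simp add: coboundaries_def)
next
  case False
  then obtain e e' where e: "e \<in> equivariant_maps G T \<rho> n" "e' \<in> equivariant_maps G T \<rho> n"
    "f = differential T n e" "f' = differential T n e'"
    using assms by (auto simp: coboundaries_def)
  have "(\<lambda>x. u *\<^sub>R f x + w *\<^sub>R f' x) = differential T n (\<lambda>x. u *\<^sub>R e x + w *\<^sub>R e' x)"
    by (auto simp: fun_eq_iff e differential_def scaleR_sum_right sum.distrib scaleR_right_distrib mult.commute)
  then show ?thesis using False equivariant_maps_lincomb[OF e(1,2)] by (auto simp: coboundaries_def)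
qed

lemma coboundaries_zero: "(\<lambda>_. 0) \<in> coboundaries G T \<rho> n"
proof (cases "n = 0")
  case False
  have "(\<lambda>_. 0) = differential T n (\<lambda>_. 0)" by (auto simp: differential_def)
  then show ?thesis using False equivariant_maps_zero by (auto simp: coboundaries_def)
qed (simp add: coboundaries_def)

text \<open>Reduces the closure to uniform approximation on one compact set at a time. The closure
  is formed inside the space of cochains, hence the intersection with it.\<close>

lemma closed_coboundaries_iff:
  "f \<in> closed_coboundaries G T \<rho> n \<longleftrightarrow> f \<in> equivariant_maps G T \<rho> (Suc n) \<and>
    (\<forall>K \<epsilon>. compactin (power_topology T (Suc n)) K \<longrightarrow> 0 < \<epsilon> \<longrightarrow>
      (\<exists>b\<in>coboundaries G T \<rho> n \<inter> equivariant_maps G T \<rho> (Suc n). \<forall>x\<in>K. norm (b x - f x) < \<epsilon>))"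
    (is "_ \<longleftrightarrow> ?E \<and> ?A")
proof -
  let ?X = "power_topology T (Suc n)"
  let ?C = "compact_open_topology ?X"
  let ?B = "equivariant_maps G T \<rho> (Suc n) \<inter> coboundaries G T \<rho> n"
  have cm: "g \<in> continuous_maps ?X" if "g \<in> equivariant_maps G T \<rho> (Suc n)" for g
    using that by (simp add: equivariant_maps_def)
  have iff: "f \<in> closed_coboundaries G T \<rho> n \<longleftrightarrow> ?E \<and> f \<in> ?C closure_of ?B"
    unfolding closed_coboundaries_def closure_of_subtopology by blast
  have "f \<in> ?C closure_of ?B \<longleftrightarrow> ?A" if E: ?E
  proof
    assume cl: "f \<in> ?C closure_of ?B"
    show ?A
    proof (intro allI impI)
      fix K and \<epsilon> :: real assume K: "compactin ?X K" and \<epsilon>: "0 < \<epsilon>"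
      obtain U where U: "openin ?C U" "f \<in> U" "\<And>g x. g \<in> U \<Longrightarrow> x \<in> K \<Longrightarrow> norm (g x - f x) < \<epsilon>"
        using compact_open_uniform_ball[OF cm[OF E] K \<epsilon>] by metis
      then obtain b where "b \<in> ?B" "b \<in> U" using cl unfolding in_closure_of by blast
      then show "\<exists>b\<in>coboundaries G T \<rho> n \<inter> equivariant_maps G T \<rho> (Suc n). \<forall>x\<in>K. norm (b x - f x) < \<epsilon>"
        using U(3) by blast
    qed
  next
    assume A: ?A
    have "\<exists>b. b \<in> ?B \<and> b \<in> U" if fU: "f \<in> U \<and> openin ?C U" for U
    proof -
      obtain K \<epsilon> where "compactin ?X K" "0 < \<epsilon>"
        and U: "\<forall>g\<in>continuous_maps ?X. (\<forall>x\<in>K. norm (g x - f x) < \<epsilon>) \<longrightarrow> g \<in> U"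
        using compact_open_uniform_neighbourhood[of f U ?X] fU by blast
      then obtain b where "b \<in> ?B" "\<forall>x\<in>K. norm (b x - f x) < \<epsilon>" using A by blast
      then show ?thesis using U cm by blast
    qed
    moreover have "f \<in> topspace ?C"
    proof -
      have "openin ?C {f \<in> continuous_maps ?X. f ` {} \<subseteq> UNIV}"
        unfolding compact_open_topology_def by (rule topology_generated_by_Basis) blast
      then show ?thesis using cm[OF E] openin_subset by fastforce
    qed
    ultimately show "f \<in> ?C closure_of ?B" unfolding in_closure_of by blast
  qed
  then show ?thesis using iff by blast
qed

lemma closed_coboundaries_diff:
  assumes f: "f \<in> closed_coboundaries G T \<rho> n" and f': "f' \<in> closed_coboundaries G T \<rho> n"
  shows "(\<lambda>x. f x - f' x) \<in> closed_coboundaries G T \<rho> n"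
  unfolding closed_coboundaries_iff
proof (intro conjI allI impI)
  show "(\<lambda>x. f x - f' x) \<in> equivariant_maps G T \<rho> (Suc n)"
    using equivariant_maps_lincomb[of f T "Suc n" f' 1 "-1"] f f' by (simp add: closed_coboundaries_iff)
  fix K and \<epsilon> :: real assume K: "compactin (power_topology T (Suc n)) K" and "0 < \<epsilon>"
  then have \<epsilon>: "0 < \<epsilon> / 2" by simp
  obtain b b' where b: "b \<in> coboundaries G T \<rho> n \<inter> equivariant_maps G T \<rho> (Suc n)"
    "\<forall>x\<in>K. norm (b x - f x) < \<epsilon> / 2"
    and b': "b' \<in> coboundaries G T \<rho> n \<inter> equivariant_maps G T \<rho> (Suc n)"
    "\<forall>x\<in>K. norm (b' x - f' x) < \<epsilon> / 2"
    using f f' K \<epsilon> unfolding closed_coboundaries_iff by meson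
  have "norm ((b x - b' x) - (f x - f' x)) < \<epsilon>" if "x \<in> K" for x
    using norm_triangle_ineq4[of "b x - f x" "b' x - f' x"] b(2) b'(2) that
    by (smt (verit) add_diff_eq diff_add_eq diff_diff_eq2 field_sum_of_halves)
  moreover have "(\<lambda>x. b x - b' x) \<in> coboundaries G T \<rho> n \<inter> equivariant_maps G T \<rho> (Suc n)"
    using equivariant_maps_lincomb[of b T "Suc n" b' 1 "-1"] coboundaries_lincomb[of b T n b' 1 "-1"] b b'
    by simp
  ultimately show "\<exists>c\<in>coboundaries G T \<rho> n \<inter> equivariant_maps G T \<rho> (Suc n).
      \<forall>x\<in>K. norm (c x - (f x - f' x)) < \<epsilon>"
    by (intro bexI[of _ "\<lambda>x. b x - b' x"]) auto
qed

lemma closed_coboundaries_zero: "(\<lambda>_. 0) \<in> closed_coboundaries G T \<rho> n"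
  unfolding closed_coboundaries_iff
proof (intro conjI allI impI equivariant_maps_zero)
  fix K and \<epsilon> :: real assume "0 < \<epsilon>"
  then show "\<exists>b\<in>coboundaries G T \<rho> n \<inter> equivariant_maps G T \<rho> (Suc n). \<forall>x\<in>K. norm (b x - 0) < \<epsilon>"
    using coboundaries_zero equivariant_maps_zero by (intro bexI[of _ "\<lambda>_. 0"]) auto
qed

lemma cocycles_zero: "(\<lambda>_. 0) \<in> cocycles G T \<rho> n"
  by (auto simp: cocycles_def equivariant_maps_zero differential_def)

lemma cohomology_class_eq_zero:
  assumes c: "c \<in> cocycles G T \<rho> n" "c \<in> closed_coboundaries G T \<rho> n"
  shows "cohomology_class G T \<rho> n c = cohomology_class G T \<rho> n (\<lambda>_. 0)"
proof -
  have "(\<lambda>x. c x - c' x) \<in> closed_coboundaries G T \<rho> n \<longleftrightarrow> (\<lambda>x. 0 - c' x) \<in> closed_coboundaries G T \<rho> n" for c'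
    using closed_coboundaries_diff[of "\<lambda>x. c x - c' x" T n c]
      closed_coboundaries_diff[of "\<lambda>x. 0 - c' x" T n "\<lambda>x. 0 - c x"]
      closed_coboundaries_diff[OF closed_coboundaries_zero c(2)] c(2) by auto
  then show ?thesis using c(1) cocycles_zero by (auto simp: cohomology_class_def cohomologous_def)
qed

end

section \<open>The prism homotopy\<close>

text \<open>The combinatorics of the prism. \<open>D j k\<close> stands for the cocycle on face
  \<open>k\<close> of simplex \<open>j\<close>, and \<open>A j k\<close> for its value on simplex
  \<open>j\<close> of the prism over face \<open>k\<close> of the base. Outer faces of the simplices
  belong to prisms over faces of the base; the two inner faces \<open>j\<close> and
  \<open>j + 1\<close> are shared with the neighbouring simplices, so the values \<open>t\<close>
  telescope.\<close>

lemma prism_sum: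
  fixes A D :: "nat \<Rightarrow> nat \<Rightarrow> 'v::real_vector" and t :: "nat \<Rightarrow> 'v"
  assumes zero: "\<And>j. j \<le> n \<Longrightarrow> (\<Sum>k\<le>Suc n. (- 1) ^ k *\<^sub>R D j k) = 0"
    and below: "\<And>j k. k < j \<Longrightarrow> j \<le> n \<Longrightarrow> D j k = A (j - 1) k"
    and above: "\<And>j k. j \<le> k \<Longrightarrow> k < n \<Longrightarrow> D j (Suc (Suc k)) = A j (Suc k)"
    and diag: "\<And>j. j \<le> n \<Longrightarrow> D j j = t j" "\<And>j. j \<le> n \<Longrightarrow> D j (Suc j) = t (Suc j)"
  shows "(\<Sum>k\<le>n. (- 1) ^ k *\<^sub>R (\<Sum>j<n. (- 1) ^ j *\<^sub>R A j k)) = t 0 - t (Suc n)"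
proof -
  define a where "a = (\<lambda>j k. (- 1) ^ (j + k) *\<^sub>R A j k)"
  have step: "t j - t (Suc j) = (\<Sum>k<j. a (j - 1) k) + (\<Sum>k=j..<n. a j (Suc k))" if j: "j \<le> n" for j
  proof -
    \<comment> \<open>Faces before the break, the two inner faces, and faces after it. The last
      group is shifted by two, since the vertex at the break occurs twice.\<close>
    have "{..Suc n} = {..<j} \<union> ({j, Suc j} \<union> (\<lambda>k. Suc (Suc k)) ` {j..<n})"
      using j by (auto simp: image_iff) (metis Suc_le_D atLeastLessThan_iff le_neq_implies_less
        less_Suc_eq_le not_less_eq_eq Suc_le_mono linorder_not_less)
    then have split: "(\<Sum>k\<le>Suc n. (- 1) ^ (j + k) *\<^sub>R D j k) =
        (\<Sum>k<j. (- 1) ^ (j + k) *\<^sub>R D j k) + ((\<Sum>k\<in>{j, Suc j}. (- 1) ^ (j + k) *\<^sub>R D j k) +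
        (\<Sum>k\<in>(\<lambda>k. Suc (Suc k)) ` {j..<n}. (- 1) ^ (j + k) *\<^sub>R D j k))"
      by (simp only:) (subst sum.union_disjoint, simp, simp, force,
        subst sum.union_disjoint, simp, simp, force, rule refl)
    have whole: "(\<Sum>k\<le>Suc n. (- 1) ^ (j + k) *\<^sub>R D j k) = 0"
      using zero[OF j] by (simp only: power_add scaleR_scaleR[symmetric] scaleR_sum_right[symmetric]) simp
    have lower: "(\<Sum>k<j. (- 1) ^ (j + k) *\<^sub>R D j k) = - (\<Sum>k<j. a (j - 1) k)"
      unfolding sum_negf[symmetric]
    proof (rule sum.cong)
      fix k assume "k \<in> {..<j}"
      then obtain i where "j = Suc i" "k < j" by (cases j) auto
      then show "(- 1) ^ (j + k) *\<^sub>R D j k = - a (j - 1) k" using below[of k j] j by (simp add: a_def)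
    qed simp
    have middle: "(\<Sum>k\<in>{j, Suc j}. (- 1) ^ (j + k) *\<^sub>R D j k) = t j - t (Suc j)"
      using diag[OF j] by (simp add: power_add[symmetric] mult_2[symmetric])
    have upper: "(\<Sum>k\<in>(\<lambda>k. Suc (Suc k)) ` {j..<n}. (- 1) ^ (j + k) *\<^sub>R D j k) = - (\<Sum>k=j..<n. a j (Suc k))"
      unfolding sum_negf[symmetric]
      by (subst sum.reindex) (auto simp: inj_on_def a_def above intro!: sum.cong)
    show ?thesis using split[unfolded whole lower middle upper] by (simp add: algebra_simps)
  qed
  have "t 0 - t (Suc n) = (\<Sum>j\<le>n. t j - t (Suc j))"
    by (induction n) (auto simp: algebra_simps)
  also have "\<dots> = (\<Sum>j\<le>n. \<Sum>k<j. a (j - 1) k) + (\<Sum>j\<le>n. \<Sum>k=j..<n. a j (Suc k))"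
    by (simp add: step sum.distrib)
  \<comment> \<open>The first double sum is empty at \<open>j = 0\<close>, the second at
    \<open>j = n\<close>. After the shift both run over \<open>j < n\<close>, and for each
    \<open>j\<close> they cover \<open>k \<le> j\<close> and \<open>k > j\<close>.\<close>
  also have "(\<Sum>j\<le>n. \<Sum>k<j. a (j - 1) k) = (\<Sum>j<n. \<Sum>k<Suc j. a j k)"
    by (simp only: lessThan_Suc_atMost[symmetric] sum.lessThan_Suc_shift) simp
  also have "(\<Sum>j\<le>n. \<Sum>k=j..<n. a j (Suc k)) = (\<Sum>j<n. \<Sum>k=j..<n. a j (Suc k))"
    by (simp only: lessThan_Suc_atMost[symmetric] sum.lessThan_Suc) simp
  also have "(\<Sum>j<n. \<Sum>k<Suc j. a j k) + (\<Sum>j<n. \<Sum>k=j..<n. a j (Suc k)) = (\<Sum>j<n. \<Sum>k\<le>n. a j k)"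
    unfolding sum.distrib[symmetric]
  proof (rule sum.cong)
    fix j assume "j \<in> {..<n}"
    then have "{..n} = {..<Suc j} \<union> Suc ` {j..<n}"
      by (auto simp: image_Suc_atLeastLessThan)
    moreover have "sum (a j) ({..<Suc j} \<union> Suc ` {j..<n}) = sum (a j) {..<Suc j} + sum (a j) (Suc ` {j..<n})"
      by (rule sum.union_disjoint) auto
    moreover have "sum (a j) (Suc ` {j..<n}) = (\<Sum>k=j..<n. a j (Suc k))"
      by (subst sum.reindex) auto
    ultimately show "(\<Sum>k<Suc j. a j k) + (\<Sum>k=j..<n. a j (Suc k)) = (\<Sum>k\<le>n. a j k)"
      by (simp only:)
  qed simp
  also have "\<dots> = (\<Sum>k\<le>n. \<Sum>j<n. a j k)" by (rule sum.swap)
  also have "\<dots> = (\<Sum>k\<le>n. (- 1) ^ k *\<^sub>R (\<Sum>j<n. (- 1) ^ j *\<^sub>R A j k))"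
    by (simp add: a_def scaleR_sum_right power_add mult.commute)
  finally show ?thesis by simp
qed

text \<open>The prism over \<open>x\<close> joins \<open>x\<close> to its right translate by \<open>z\<close>, which is also a left translate if
  \<open>z\<close> centralizes the entries of \<open>x\<close>. Its simplices have the vertices
  \<open>x\<^sub>0, \<dots>, x\<^sub>j, x\<^sub>j z, \<dots>, x\<^sub>m\<^sub>-\<^sub>1 z\<close>.\<close>

definition prism_simplex ::
    "('g, 's) monoid_scheme \<Rightarrow> nat \<Rightarrow> 'g \<Rightarrow> nat \<Rightarrow> (nat \<Rightarrow> 'g) \<Rightarrow> (nat \<Rightarrow> 'g)"
  where "prism_simplex G m z j x = (\<lambda>i\<in>{..<Suc m}. if i \<le> j then x i else x (i - 1) \<otimes>\<^bsub>G\<^esub> z)"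

text \<open>The homotopy operator. It evaluates a cochain of \<open>G\<close>, since the vertices
  \<open>x i \<otimes> z\<close> may leave \<open>N\<close>, yet yields a cochain of
  \<open>N\<close>.\<close>

definition prism_cochain ::
    "('g, 's) monoid_scheme \<Rightarrow> 'g set \<Rightarrow> nat \<Rightarrow> 'g \<Rightarrow> ((nat \<Rightarrow> 'g) \<Rightarrow> 'v::banach) \<Rightarrow> ((nat \<Rightarrow> 'g) \<Rightarrow> 'v)"
  where "prism_cochain G N m z c = (\<lambda>x.
    if x \<in> {..<m} \<rightarrow>\<^sub>E N then \<Sum>j<m. (- 1) ^ j *\<^sub>R c (prism_simplex G m z j x) else 0)"

lemma omit_PiE: "k \<le> n \<Longrightarrow> x \<in> {..<Suc n} \<rightarrow>\<^sub>E N \<Longrightarrow> omit n k x \<in> {..<n} \<rightarrow>\<^sub>E N"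
  by (auto simp: omit_def PiE_iff)

section \<open>The homotopy over a centralized subgroup\<close>

locale centralized_subgroup = topological_group G T + banach_module_group G scl \<rho>
  for G :: "('g, 's) monoid_scheme" (structure) and T
    and scl :: "'k::real_or_complex \<Rightarrow> 'v::banach \<Rightarrow> 'v" and \<rho> +
  fixes N C
  assumes N: "subgroup N G" and C: "subgroup C G" and central: "C \<subseteq> centralizer G N"
begin

abbreviation H where "H \<equiv> G\<lparr>carrier := N\<rparr>"
abbreviation TN where "TN \<equiv> subtopology T N"

lemma N_carrier: "x \<in> N \<Longrightarrow> x \<in> carrier G"
  using subgroup.subset[OF N] by blast

lemma C_carrier: "x \<in> C \<Longrightarrow> x \<in> carrier G"
  using subgroup.subset[OF C] by blast

lemma commute: "x \<in> N \<Longrightarrow> z \<in> C \<Longrightarrow> z \<otimes> x = x \<otimes> z"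
  using central by (auto simp: centralizer_def)

lemma topspace_power: "topspace (power_topology T m) = {..<m} \<rightarrow>\<^sub>E carrier G"
  by (simp add: topspace_eq)

lemma topspace_power_N: "topspace (power_topology TN m) = {..<m} \<rightarrow>\<^sub>E N"
  using subgroup.subset[OF N] by (simp add: topspace_eq inf_absorb2)

lemma PiE_N: "x \<in> {..<m} \<rightarrow>\<^sub>E N \<Longrightarrow> x \<in> {..<m} \<rightarrow>\<^sub>E carrier G"
  using N_carrier by (auto simp: PiE_iff)

sublocale sub: banach_module_group H scl \<rho>
proof (intro banach_module_group.intro banach_module_group_axioms.intro)
  show "group H" by (rule subgroup_imp_group[OF N])
  show "banach_module scl H \<rho>"
    using banach_module N_carrier by (auto simp: banach_module_def hom_def)
qed

lemma prism_simplex_PiE: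
  assumes "x \<in> {..<m} \<rightarrow>\<^sub>E N" "z \<in> C" "j < m"
  shows "prism_simplex G m z j x \<in> {..<Suc m} \<rightarrow>\<^sub>E carrier G"
proof -
  have "x i \<in> carrier G" if "i < m" for i using assms(1) that N_carrier by blast
  then show ?thesis using assms(3) C_carrier[OF assms(2)] by (auto simp: prism_simplex_def PiE_iff)
qed

lemma continuous_prism_simplex:
  assumes "z \<in> C" "j < m"
  shows "continuous_map (power_topology TN m) (power_topology T (Suc m)) (prism_simplex G m z j)"
  unfolding continuous_map_componentwise
proof (intro conjI ballI)
  show "prism_simplex G m z j ` topspace (power_topology TN m) \<subseteq> extensional {..<Suc m}"
    by (auto simp: prism_simplex_def)
  have proj: "continuous_map (power_topology TN m) T (\<lambda>x. x i)" if "i < m" for i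
    using continuous_map_product_projection[of i "{..<m}" "\<lambda>_. TN"] that
    by (auto intro: continuous_map_into_fulltopology)
  have right: "continuous_map T T (\<lambda>x. x \<otimes> z)"
    using continuous_map_compose[OF _ continuous_mult, of T "\<lambda>x. (x, z)"] C_carrier[OF assms(1)]
    by (simp add: continuous_map_pairedI topspace_eq comp_def)
  fix i assume i: "i \<in> {..<Suc m}"
  show "continuous_map (power_topology TN m) T (\<lambda>x. prism_simplex G m z j x i)"
  proof (cases "i \<le> j")
    case True
    then show ?thesis using i assms(2) proj[of i] by (simp add: prism_simplex_def)
  next
    case False
    then have "continuous_map (power_topology TN m) T (\<lambda>x. x (i - 1) \<otimes> z)"
      using i continuous_map_compose[OF proj[of "i - 1"] right] by (auto simp: comp_def)
    then show ?thesis using i False by (simp add: prism_simplex_def)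
  qed
qed

text \<open>Left and right multiplication commute by associativity, so \<open>g\<close> carries each
  simplex over \<open>x\<close> to the corresponding one over its translate.\<close>

lemma prism_cochain_equivariant:
  assumes c: "c \<in> equivariant_maps G T \<rho> (Suc m)" and z: "z \<in> C"
  shows "prism_cochain G N m z c \<in> equivariant_maps H TN \<rho> m"
proof -
  have cont: "continuous_map (power_topology T (Suc m)) euclidean c"
    and eq: "\<And>g x. g \<in> carrier G \<Longrightarrow> x \<in> {..<Suc m} \<rightarrow>\<^sub>E carrier G \<Longrightarrow> c (translate G (Suc m) g x) = \<rho> g (c x)"
    using c unfolding equivariant_maps_def continuous_maps_def topspace_power by auto
  have "continuous_map (power_topology TN m) euclidean
      (\<lambda>x. \<Sum>j<m. (- 1) ^ j *\<^sub>R c (prism_simplex G m z j x))"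
    using continuous_map_compose[OF continuous_prism_simplex[OF z] cont]
    by (auto intro!: continuous_map_sum continuous_map_bounded_linear[OF bounded_linear_scaleR_right]
        simp: comp_def)
  then have "continuous_map (power_topology TN m) euclidean (prism_cochain G N m z c)"
    by (rule continuous_map_eq) (auto simp: topspace_power_N prism_cochain_def simp del: topspace_product_topology)
  moreover have "prism_cochain G N m z c (translate H m g x) = \<rho> g (prism_cochain G N m z c x)"
    if g: "g \<in> N" and x: "x \<in> {..<m} \<rightarrow>\<^sub>E N" for g x
  proof -
    have xi: "x i \<in> carrier G" if "i < m" for i using x that N_carrier by blast
    have tr: "translate H m g x \<in> {..<m} \<rightarrow>\<^sub>E N"
      using g x subgroup.m_closed[OF N] by (auto simp: translate_def PiE_iff)
    have "c (prism_simplex G m z j (translate H m g x)) = \<rho> g (c (prism_simplex G m z j x))" if j: "j < m" for j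
    proof -
      have "prism_simplex G m z j (translate H m g x) = translate G (Suc m) g (prism_simplex G m z j x)"
        using j xi N_carrier[OF g] C_carrier[OF z]
        by (auto simp: prism_simplex_def translate_def restrict_def fun_eq_iff m_assoc)
      then show ?thesis using eq[OF N_carrier[OF g] prism_simplex_PiE[OF x z j]] by simp
    qed
    then show ?thesis using x tr linear[OF N_carrier[OF g]]
      by (simp add: prism_cochain_def linear_sum linear_scale)
  qed
  ultimately show ?thesis
    unfolding equivariant_maps_def continuous_maps_def topspace_power_N
    by (auto simp: prism_cochain_def)
qed

text \<open>With one vertex fewer before it, the break moves from \<open>j\<close> to
  \<open>j - 1\<close>.\<close>

lemma omit_prism_simplex_below:
  assumes "k < j" "j \<le> n"
  shows "omit (Suc n) k (prism_simplex G (Suc n) z j x) = prism_simplex G n z (j - 1) (omit n k x)"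
  using assms by (auto simp: omit_def prism_simplex_def fun_eq_iff restrict_def)

text \<open>After the break positions are shifted by one: vertex \<open>k + 2\<close> is the
  translate of entry \<open>k + 1\<close>.\<close>

lemma omit_prism_simplex_above:
  assumes "j \<le> k" "k < n"
  shows "omit (Suc n) (Suc (Suc k)) (prism_simplex G (Suc n) z j x) = prism_simplex G n z j (omit n (Suc k) x)"
  using assms by (auto simp: omit_def prism_simplex_def fun_eq_iff restrict_def)

lemma differential_prism_cochain:
  assumes c: "c \<in> cocycles G T \<rho> n" and z: "z \<in> C"
  shows "differential TN n (prism_cochain G N n z c) = (\<lambda>x.
    \<rho> z (restrict_cochain T N n c x) - restrict_cochain T N n c x)"
proof
  fix x
  show "differential TN n (prism_cochain G N n z c) x =
    \<rho> z (restrict_cochain T N n c x) - restrict_cochain T N n c x"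
  proof (cases "x \<in> {..<Suc n} \<rightarrow>\<^sub>E N")
    case False
    then show ?thesis
      using linear_0[OF linear[OF C_carrier[OF z]]]
      by (simp add: differential_def restrict_cochain_def topspace_power_N del: topspace_product_topology)
  next
    case True
    have dc: "differential T (Suc n) c = (\<lambda>_. 0)"
      and eq: "\<And>g x. g \<in> carrier G \<Longrightarrow> x \<in> {..<Suc n} \<rightarrow>\<^sub>E carrier G \<Longrightarrow> c (translate G (Suc n) g x) = \<rho> g (c x)"
      using c unfolding cocycles_def equivariant_maps_def topspace_power by auto
    \<comment> \<open>The value on the inner face where the first \<open>j\<close> entries are still
      untranslated; it interpolates between the right translate of \<open>x\<close> at 0 and
      \<open>x\<close> itself at \<open>n + 1\<close>.\<close>
    define t where "t j = c (\<lambda>i\<in>{..<Suc n}. if i < j then x i else x i \<otimes> z)" for j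
    have "(\<Sum>k\<le>n. (- 1) ^ k *\<^sub>R (\<Sum>j<n. (- 1) ^ j *\<^sub>R c (prism_simplex G n z j (omit n k x)))) = t 0 - t (Suc n)"
    proof (rule prism_sum[where D = "\<lambda>j k. c (omit (Suc n) k (prism_simplex G (Suc n) z j x))"])
      show "(\<Sum>k\<le>Suc n. (- 1) ^ k *\<^sub>R c (omit (Suc n) k (prism_simplex G (Suc n) z j x))) = 0" if "j \<le> n" for j
        using fun_cong[OF dc, of "prism_simplex G (Suc n) z j x"]
          prism_simplex_PiE[OF True z, of j] that
        unfolding differential_def topspace_power by simp
      show "c (omit (Suc n) j (prism_simplex G (Suc n) z j x)) = t j" if "j \<le> n" for j
        unfolding t_def using that
        by (intro arg_cong[of _ _ c]) (auto simp: omit_def prism_simplex_def fun_eq_iff restrict_def)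
      show "c (omit (Suc n) (Suc j) (prism_simplex G (Suc n) z j x)) = t (Suc j)" if "j \<le> n" for j
        unfolding t_def using that
        by (intro arg_cong[of _ _ c]) (auto simp: omit_def prism_simplex_def fun_eq_iff restrict_def)
    qed (simp_all add: omit_prism_simplex_below omit_prism_simplex_above)
    \<comment> \<open>Centralizing enters here: the right translate of \<open>x\<close> by
      \<open>z\<close> is also its left translate, to which equivariance of \<open>c\<close>
      applies.\<close>
    moreover have "t 0 = \<rho> z (c x)"
    proof -
      have "(\<lambda>i\<in>{..<Suc n}. x i \<otimes> z) = translate G (Suc n) z x"
        using True commute[OF _ z] by (auto simp: translate_def fun_eq_iff restrict_def PiE_iff)
      then show ?thesis using eq[OF C_carrier[OF z] PiE_N[OF True]] by (simp add: t_def)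
    qed
    moreover have "(\<lambda>i\<in>{..<Suc n}. if i < Suc n then x i else x i \<otimes> z) = x"
      using True by (auto simp: fun_eq_iff restrict_def PiE_iff extensional_def)
    then have "t (Suc n) = c x" by (simp add: t_def)
    moreover have "differential TN n (prism_cochain G N n z c) x =
        (\<Sum>k\<le>n. (- 1) ^ k *\<^sub>R (\<Sum>j<n. (- 1) ^ j *\<^sub>R c (prism_simplex G n z j (omit n k x))))"
      using True omit_PiE[OF _ True]
      by (simp add: differential_def topspace_power_N prism_cochain_def del: topspace_product_topology)
    ultimately show ?thesis
      using True by (simp add: restrict_cochain_def topspace_power_N del: topspace_product_topology)
  qed
qed

lemma restrict_cochain_cocycle:
  assumes c: "c \<in> cocycles G T \<rho> n"
  shows "restrict_cochain T N n c \<in> cocycles H TN \<rho> n"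
proof -
  have dc: "differential T (Suc n) c = (\<lambda>_. 0)"
    and cont: "continuous_map (power_topology T (Suc n)) euclidean c"
    and eq: "\<And>g x. g \<in> carrier G \<Longrightarrow> x \<in> {..<Suc n} \<rightarrow>\<^sub>E carrier G \<Longrightarrow> c (translate G (Suc n) g x) = \<rho> g (c x)"
    using c unfolding cocycles_def equivariant_maps_def continuous_maps_def topspace_power by auto
  have "continuous_map (power_topology TN (Suc n)) (power_topology T (Suc n)) (\<lambda>x. x)"
    unfolding continuous_map_componentwise
    using continuous_map_product_projection[of _ "{..<Suc n}" "\<lambda>_. TN"]
    by (auto intro: continuous_map_into_fulltopology simp: PiE_iff)
  from continuous_map_compose[OF this cont]
  have "continuous_map (power_topology TN (Suc n)) euclidean (restrict_cochain T N n c)"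
    by (rule continuous_map_eq) (auto simp: restrict_cochain_def)
  moreover have "restrict_cochain T N n c (translate H (Suc n) g x) = \<rho> g (restrict_cochain T N n c x)"
    if g: "g \<in> N" and x: "x \<in> {..<Suc n} \<rightarrow>\<^sub>E N" for g x
  proof -
    have "translate H (Suc n) g x \<in> {..<Suc n} \<rightarrow>\<^sub>E N"
      using g x subgroup.m_closed[OF N] by (auto simp: translate_def PiE_iff)
    moreover have "translate H (Suc n) g x = translate G (Suc n) g x" by (simp add: translate_def)
    ultimately show ?thesis using eq[OF N_carrier[OF g] PiE_N[OF x]] x
      unfolding restrict_cochain_def topspace_power_N by simp
  qed
  ultimately have "restrict_cochain T N n c \<in> equivariant_maps H TN \<rho> (Suc n)"
    unfolding equivariant_maps_def continuous_maps_def topspace_power_N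
    by (auto simp: restrict_cochain_def topspace_power_N simp del: topspace_product_topology)
  moreover have "differential TN (Suc n) (restrict_cochain T N n c) x = 0" for x
  proof (cases "x \<in> {..<Suc (Suc n)} \<rightarrow>\<^sub>E N")
    case True
    then have "differential TN (Suc n) (restrict_cochain T N n c) x = differential T (Suc n) c x"
      using omit_PiE[OF _ True] PiE_N[OF True]
      by (simp add: differential_def restrict_cochain_def topspace_power_N topspace_power
          del: topspace_product_topology sum.atMost_Suc)
    then show ?thesis by (simp add: dc)
  qed (simp add: differential_def topspace_power_N del: topspace_product_topology)
  ultimately show ?thesis by (auto simp: cocycles_def)
qed

text \<open>For a single operator this is the homotopy formula up to sign, and
  \<open>\<rho> z\<close> preserves equivariance because it commutes with \<open>\<rho> g\<close>
  for \<open>g\<close> in \<open>N\<close>. Weights adding up to 1 let the difference from a mixture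
  split into the two differences.\<close>

lemma restrict_minus_average_coboundary:
  assumes c: "c \<in> cocycles G T \<rho> n" and "m \<in> averages (\<rho> ` C)"
  shows "(\<lambda>x. restrict_cochain T N n c x - m (restrict_cochain T N n c x))
    \<in> coboundaries H TN \<rho> n \<inter> equivariant_maps H TN \<rho> (Suc n)"
  using assms(2)
proof (induction rule: averages.induct)
  case (base s)
  then obtain z where z: "z \<in> C" "s = \<rho> z" by blast
  let ?r = "restrict_cochain T N n c"
  have r: "?r \<in> equivariant_maps H TN \<rho> (Suc n)"
    using restrict_cochain_cocycle[OF c] by (simp add: cocycles_def)
  have d: "differential TN n (prism_cochain G N n z c) = (\<lambda>x. \<rho> z (?r x) - ?r x)"
    by (rule differential_prism_cochain[OF c z(1)])
  have "(\<lambda>x. \<rho> z (?r x)) \<in> equivariant_maps H TN \<rho> (Suc n)"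
  proof -
    have "\<rho> z (\<rho> g v) = \<rho> g (\<rho> z v)" if "g \<in> N" for g v
      using rep_mult[of z g v] rep_mult[of g z v] commute[OF that z(1)] N_carrier[OF that] C_carrier[OF z(1)]
      by simp
    then show ?thesis using r linear_0[OF linear[OF C_carrier[OF z(1)]]]
      by (auto simp: equivariant_maps_def continuous_maps_def
          intro: continuous_map_bounded_linear[OF bounded_linear[OF C_carrier[OF z(1)]]])
  qed
  from sub.equivariant_maps_lincomb[OF r this, of 1 "-1"]
  have "(\<lambda>x. ?r x - \<rho> z (?r x)) \<in> equivariant_maps H TN \<rho> (Suc n)" by simp
  moreover have "(\<lambda>x. \<rho> z (?r x) - ?r x) \<in> coboundaries H TN \<rho> n"
  \<comment> \<open>In degree 0 the prism sum is empty, so the formula gives difference 0, in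
    agreement with the convention for coboundaries there.\<close>
  proof (cases "n = 0")
    case True
    then have "prism_cochain G N n z c = (\<lambda>_. 0)" by (auto simp: prism_cochain_def)
    then have "differential TN n (prism_cochain G N n z c) = (\<lambda>_. 0)" by (auto simp: differential_def)
    then show ?thesis using True d by (simp add: coboundaries_def)
  next
    case False
    have "c \<in> equivariant_maps G T \<rho> (Suc n)" using c by (simp add: cocycles_def)
    from prism_cochain_equivariant[OF this z(1)] show ?thesis
      using False d[symmetric] by (simp add: coboundaries_def)
  qed
  from sub.coboundaries_lincomb[OF this this, of "-1" 0]
  have "(\<lambda>x. ?r x - \<rho> z (?r x)) \<in> coboundaries H TN \<rho> n" by simp
  ultimately show ?case using z(2) by simp
next
  case (mix m m' u w)
  let ?r = "restrict_cochain T N n c"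
  have "(\<lambda>x. ?r x - (u *\<^sub>R m (?r x) + w *\<^sub>R m' (?r x))) =
      (\<lambda>x. u *\<^sub>R (?r x - m (?r x)) + w *\<^sub>R (?r x - m' (?r x)))"
  proof
    fix x
    have "?r x = u *\<^sub>R ?r x + w *\<^sub>R ?r x" using mix.hyps(5) by (metis scaleR_left_distrib scaleR_one)
    then show "?r x - (u *\<^sub>R m (?r x) + w *\<^sub>R m' (?r x)) =
        u *\<^sub>R (?r x - m (?r x)) + w *\<^sub>R (?r x - m' (?r x))" by (simp add: algebra_simps)
  qed
  then show ?case
    using mix.IH sub.coboundaries_lincomb sub.equivariant_maps_lincomb by simp
qed

section \<open>The two conclusions\<close>

text \<open>The image of a compact set \<open>K\<close> under the restricted cochain is norm
  compact. If \<open>m\<close> is small on it, the coboundary obtained by subtracting the average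
  approximates the cochain on \<open>K\<close>.\<close>

theorem restriction_map_zero:
  assumes wap: "weakly_almost_periodic scl G \<rho>" and fixed: "fixed_vectors \<rho> C = {0}"
    and \<xi>: "\<xi> \<in> reduced_cohomology G T \<rho> n"
  shows "restriction_map G T \<rho> N n \<xi> = cohomology_class H TN \<rho> n (\<lambda>_. 0)"
proof -
  obtain c where c: "c \<in> cocycles G T \<rho> n" "\<xi> = cohomologous G T \<rho> n `` {c}"
    using \<xi> unfolding reduced_cohomology_def by (rule quotientE)
  \<comment> \<open>The class is nonempty, so a union of equal sets indexed by it is that
    set.\<close>
  have "c \<in> \<xi>" using c closed_coboundaries_zero[of T n] by (simp add: cohomologous_def)
  moreover have "cohomology_class H TN \<rho> n (restrict_cochain T N n c') = cohomology_class H TN \<rho> n (\<lambda>_. 0)"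
    if "c' \<in> \<xi>" for c'
  proof -
    let ?r = "restrict_cochain T N n c'"
    have c': "c' \<in> cocycles G T \<rho> n" using that c(2) by (simp add: cohomologous_def)
    have r: "?r \<in> cocycles H TN \<rho> n" by (rule restrict_cochain_cocycle[OF c'])
    have "?r \<in> closed_coboundaries H TN \<rho> n"
      unfolding sub.closed_coboundaries_iff
    proof (intro conjI allI impI)
      show E: "?r \<in> equivariant_maps H TN \<rho> (Suc n)" using r by (simp add: cocycles_def)
      fix K and \<epsilon> :: real assume K: "compactin (power_topology TN (Suc n)) K" and \<epsilon>: "0 < \<epsilon>"
      have "?r \<in> continuous_maps (power_topology TN (Suc n))" using E by (simp add: equivariant_maps_def)
      then obtain m where m: "m \<in> averages (\<rho> ` C)" "\<And>v. v \<in> ?r ` K \<Longrightarrow> norm (m v) < \<epsilon>"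
        using averages_small_on_compact[OF C wap fixed compact_image_continuous_maps[OF _ K] \<epsilon>] by metis
      then show "\<exists>b\<in>coboundaries H TN \<rho> n \<inter> equivariant_maps H TN \<rho> (Suc n). \<forall>x\<in>K. norm (b x - ?r x) < \<epsilon>"
        by (intro bexI[OF _ restrict_minus_average_coboundary[OF c' m(1)]]) auto
    qed
    then show ?thesis by (rule sub.cohomology_class_eq_zero[OF r])
  qed
  ultimately show ?thesis unfolding restriction_map_def by blast
qed

theorem almost_fixes_point_restriction:
  assumes \<alpha>: "affine_isometric_action scl G \<alpha> \<rho> b" "pointwise_continuous T \<alpha>"
    and wap: "weakly_almost_periodic scl G \<rho>" and fixed: "fixed_vectors \<rho> C = {0}"
  shows "almost_fixes_point TN \<alpha>"
  unfolding almost_fixes_point_def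
proof (intro allI impI, elim conjE)
  fix K and \<epsilon> :: real assume K: "compactin TN K" and \<epsilon>: "0 < \<epsilon>"
  have act: "\<And>g v. g \<in> carrier G \<Longrightarrow> \<alpha> g v = \<rho> g v + b g" and ga: "group_action G UNIV \<alpha>"
    using \<alpha>(1) by (auto simp: affine_isometric_action_def)
  have cocycle: "b (g \<otimes> h) = b g + \<rho> g (b h)" if "g \<in> carrier G" "h \<in> carrier G" for g h
    using group_action.composition_rule[OF ga _ that, of 0] act that linear_0[OF linear] by simp
  \<comment> \<open>The homotopy in degree one: expand \<open>b\<close> at
    \<open>h \<otimes> z\<close> and at \<open>z \<otimes> h\<close> by the cocycle identity and
    compare.\<close>
  have exch: "b h - \<rho> z (b h) = b z - \<rho> h (b z)" if "h \<in> N" "z \<in> C" for h z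
    using cocycle[of h z] cocycle[of z h] commute[OF that] N_carrier[OF that(1)] C_carrier[OF that(2)]
    by (simp add: algebra_simps)
  have "continuous_map TN euclidean b"
  proof (rule continuous_map_eq)
    show "continuous_map TN euclidean (\<lambda>g. \<alpha> g 0)"
      using \<alpha>(2) unfolding pointwise_continuous_def by (intro continuous_map_from_subtopology) blast
    show "\<alpha> g 0 = b g" if "g \<in> topspace TN" for g
      using that act[of g 0] linear_0[OF linear] by (simp add: topspace_eq)
  qed
  then have "compact (b ` K)" using image_compactin[OF K, of euclidean b] by simp
  then obtain m where m: "m \<in> averages (\<rho> ` C)" "\<And>v. v \<in> b ` K \<Longrightarrow> norm (m v) < \<epsilon>"
    using averages_small_on_compact[OF C wap fixed _ \<epsilon>] by metis
  \<comment> \<open>For \<open>m = \<rho> z\<close> the point is \<open>b z\<close>; mixtures take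
    the same convex combination of points. Such a \<open>v\<close> is displaced by
    \<open>\<alpha> h\<close> exactly by \<open>m (b h)\<close>.\<close>
  have "\<exists>v. \<forall>h\<in>N. b h - m (b h) = v - \<rho> h v"
    using m(1)
  proof (induction rule: averages.induct)
    case (base s)
    then show ?case using exch by blast
  next
    case (mix m m' u w)
    then obtain v v' where v: "\<And>h. h \<in> N \<Longrightarrow> b h - m (b h) = v - \<rho> h v"
      "\<And>h. h \<in> N \<Longrightarrow> b h - m' (b h) = v' - \<rho> h v'" by blast
    have "b h - (u *\<^sub>R m (b h) + w *\<^sub>R m' (b h)) = (u *\<^sub>R v + w *\<^sub>R v') - \<rho> h (u *\<^sub>R v + w *\<^sub>R v')"
      if h: "h \<in> N" for h
    proof -
      have "b h = u *\<^sub>R b h + w *\<^sub>R b h" using mix.hyps(5) by (metis scaleR_left_distrib scaleR_one)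
      then have "b h - (u *\<^sub>R m (b h) + w *\<^sub>R m' (b h)) = u *\<^sub>R (b h - m (b h)) + w *\<^sub>R (b h - m' (b h))"
        by (simp add: algebra_simps)
      also have "\<dots> = u *\<^sub>R (v - \<rho> h v) + w *\<^sub>R (v' - \<rho> h v')" using v h by simp
      finally show ?thesis
        using linear[OF N_carrier[OF h]] by (simp add: linear_add linear_scale algebra_simps)
    qed
    then show ?case by blast
  qed
  then obtain v where v: "\<And>h. h \<in> N \<Longrightarrow> b h - m (b h) = v - \<rho> h v" by blast
  have "norm (\<alpha> h v - v) < \<epsilon>" if h: "h \<in> K" for h
  proof -
    have hN: "h \<in> N" using h K compactin_subset_topspace by fastforce
    have "\<alpha> h v - v = m (b h)" using v[OF hN] act[OF N_carrier[OF hN]] by (simp add: algebra_simps)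
    then show ?thesis using m(2) h by simp
  qed
  then show "\<exists>v. \<forall>h\<in>K. norm (\<alpha> h v - v) < \<epsilon>" by blast
qed

end

theorem theorem2:
  fixes G :: "('g, 's) monoid_scheme"
    and T :: "'g topology"
    and N C :: "'g set"
    and scl :: "'k::real_or_complex \<Rightarrow> 'v::banach \<Rightarrow> 'v"
  assumes "topological_group G T"
    and "subgroup N G"
    and "subgroup C G"
    and "C \<subseteq> centralizer G N"
    and "banach_space scl"
  shows "(\<forall>\<rho>. banach_module scl G \<rho> \<and> pointwise_continuous T \<rho> \<and>
            weakly_almost_periodic scl G \<rho> \<and> fixed_vectors \<rho> C = {0} \<longrightarrow>
          (\<forall>n. \<forall>\<xi>\<in>reduced_cohomology G T \<rho> n.
            restriction_map G T \<rho> N n \<xi> =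
            cohomology_class (G\<lparr>carrier := N\<rparr>) (subtopology T N) \<rho> n (\<lambda>_. 0))) \<and>
         (\<forall>\<alpha> \<rho> b. affine_isometric_action scl G \<alpha> \<rho> b \<and> pointwise_continuous T \<alpha> \<and>
            weakly_almost_periodic scl G \<rho> \<and> fixed_vectors \<rho> C = {0} \<longrightarrow>
          almost_fixes_point (subtopology T N) \<alpha>)"
proof -
  have cs: "centralized_subgroup G T scl \<rho> N C" if "banach_module scl G \<rho>" for \<rho>
    using assms that
    by (simp add: centralized_subgroup_def centralized_subgroup_axioms_def banach_module_group_def
        banach_module_group_axioms_def topological_group_def)
  show ?thesis
  proof (intro conjI allI impI ballI; elim conjE)
    show "restriction_map G T \<rho> N n \<xi> =
        cohomology_class (G\<lparr>carrier := N\<rparr>) (subtopology T N) \<rho> n (\<lambda>_. 0)"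
      if "banach_module scl G \<rho>" "weakly_almost_periodic scl G \<rho>" "fixed_vectors \<rho> C = {0}"
        "\<xi> \<in> reduced_cohomology G T \<rho> n" for \<rho> n \<xi>
      using centralized_subgroup.restriction_map_zero[OF cs] that by blast
    show "almost_fixes_point (subtopology T N) \<alpha>"
      if "affine_isometric_action scl G \<alpha> \<rho> b" "pointwise_continuous T \<alpha>"
        "weakly_almost_periodic scl G \<rho>" "fixed_vectors \<rho> C = {0}" for \<alpha> \<rho> b
      using centralized_subgroup.almost_fixes_point_restriction[OF cs that] that(1)
      by (simp add: affine_isometric_action_def)
  qed
qed

end
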